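(* Let $\mathcal{P}_{<\omega}\mathbb{N}$ be the family of finite subsets of $\mathbb{N}$ and $\theta:\mathcal{P}\mathbb{N}\to\{0,1\}^{\mathbb{N}}$ the bijection sending a set to its characteristic function. Then: (1) $\theta(\mathcal{P}_{<\omega}\mathbb{N})$ is Wadge complete for $\mathbf{\Sigma}^0_2(2^\omega)$ and effectively Wadge complete for $\Sigma^0_2(2^\omega)$; in particular it is in $\Sigma^0_2(2^\omega)\setminus\mathbf{\Pi}^0_2(2^\omega)$. (2) $\mathcal{P}_{<\omega}\mathbb{N}\in\Sigma^0_2(\mathcal{P}\mathbb{N})\setminus\mathbf{\Pi}^0_2(\mathcal{P}\mathbb{N})$. (3) $\mathcal{P}_{<\omega}\mathbb{N}$ is Wadge hard for $\mathbf{\Sigma}^0_2(2^\omega)$ and for $\mathbf{\Pi}^0_1(\mathcal{P}\mathbb{N})$. (4) No nonempty $\mathbf{\Sigma}^0_1(\mathcal{P}\mathbb{N})$ family is Wadge reducible to $\mathcal{P}_{<\omega}\mathbb{N}$. (5) No subfamily of $\mathcal{P}_{<\omega}\mathbb{N}$ is Wadge hard for $\mathbf{\Sigma}^0_2(\mathcal{P}\mathbb{N})$. Items (3), (4), (5) also hold in their effective versions.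
   Context: $\mathcal{P}\mathbb{N}$ is the powerset of $\mathbb{N}$ with the Scott topology (basic opens $\mathcal{B}_A=\{X:A\subseteq X\}$, $A$ finite; canonical presentation $(\mathcal{B}_A)$); $2^\omega$ is the Cantor space $\{0,1\}^{\mathbb{N}}$ with the product topology. In any space, $\mathbf{\Sigma}^0_1$ = open sets, $\mathbf{\Pi}^0_1$ = closed sets, $\mathbf{\Sigma}^0_2$ = countable unions of differences of two open sets, $\mathbf{\Pi}^0_2$ = complements of $\mathbf{\Sigma}^0_2$ sets; lightface $\Sigma^0_1,\Sigma^0_2,\Pi^0_1$ are the effective versions relative to the standard presentation (c.e. unions of basic opens; unions of differences given by uniformly c.e. index sets). A set $H$ in a space $Y$ is Wadge hard for a class $\mathcal{C}$ of subsets of a space $X$ if every member of $\mathcal{C}$ is $f^{-1}(H)$ for some continuous $f:X\to Y$; Wadge complete if moreover $H\in\mathcal{C}$ (with $X=Y$). Effective versions require computable/effective continuous reductions (for $\mathcal{P}\mathbb{N}$, $f$ effective iff $\{(A,B):f(\mathcal{B}_A)\subseteq\mathcal{B}_B\}$ is c.e.) and effective classes.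
   Formalization: In item (4), and in its effective version, the family is also assumed different from the whole space PN, since PN is a nonempty open family that reduces to the finite sets by a constant map. *)

theory Defs
  imports "HOL-Analysis.Analysis" "HOL-Library.Nat_Bijection"
begin

section \<open>Computably enumerable sets of natural numbers\<close>

text \<open>
  \<open>total_rec n f\<close>: the function \<open>f\<close>, on argument lists of length \<open>n\<close>, is total (general)
  recursive in Kleene's sense. Values of \<open>f\<close> on lists of other lengths are junk. The recursion
  variable of \<open>prec\<close> and the search variable of \<open>minimize\<close> are the first argument; \<open>minimize\<close> is only
  applied to regular functions, so that all functions stay total.
\<close>

inductive total_rec :: "nat \<Rightarrow> (nat list \<Rightarrow> nat) \<Rightarrow> bool" where
  zero: "total_rec n (\<lambda>xs. 0)"
| succ: "total_rec 1 (\<lambda>xs. Suc (xs ! 0))"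
| proj: "i < n \<Longrightarrow> total_rec n (\<lambda>xs. xs ! i)"
| comp: "total_rec m f \<Longrightarrow> length gs = m \<Longrightarrow> (\<forall>g \<in> set gs. total_rec n g) \<Longrightarrow>
    total_rec n (\<lambda>xs. f (map (\<lambda>g. g xs) gs))"
| prec: "total_rec n f \<Longrightarrow> total_rec (Suc (Suc n)) g \<Longrightarrow>
    total_rec (Suc n) (\<lambda>xs. rec_nat (f (tl xs)) (\<lambda>k r. g (k # r # tl xs)) (hd xs))"
| minimize: "total_rec (Suc n) f \<Longrightarrow> (\<forall>xs. length xs = n \<longrightarrow> (\<exists>y. f (y # xs) = 0)) \<Longrightarrow>
    total_rec n (\<lambda>xs. LEAST y. f (y # xs) = 0)"

definition computable :: "(nat \<Rightarrow> nat) \<Rightarrow> bool" where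
  "computable h \<longleftrightarrow> (\<exists>f. total_rec 1 f \<and> (\<forall>x. h x = f [x]))"

definition ce :: "nat set \<Rightarrow> bool" where
  "ce W \<longleftrightarrow> W = {} \<or> (\<exists>h. computable h \<and> W = range h)"

definition ce_rel :: "(nat \<times> nat) set \<Rightarrow> bool" where
  "ce_rel R \<longleftrightarrow> ce (prod_encode ` R)"


section \<open>The two spaces and their standard presentations\<close>

text \<open>
  A presentation of a topological space is a numbered basis \<open>b :: nat \<Rightarrow> 'a set\<close>. Finite sets of
  naturals are numbered by their canonical indices (\<^const>\<open>set_decode\<close>).
\<close>

definition scott_base :: "nat set \<Rightarrow> nat set set" where
  "scott_base A = {X. A \<subseteq> X}"

definition scott_basis :: "nat \<Rightarrow> nat set set" where
  "scott_basis i = scott_base (set_decode i)"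

definition scott :: "nat set topology" where
  "scott = topology_generated_by {scott_base A | A. finite A}"

definition cantor :: "(nat \<Rightarrow> bool) topology" where
  "cantor = product_topology (\<lambda>_. discrete_topology UNIV) UNIV"

text \<open>
  The number \<open>prod_encode (n, a)\<close> names the cylinder of the binary string formed by the \<open>n\<close> low-order
  bits of \<open>a\<close>.
\<close>

definition cantor_basis :: "nat \<Rightarrow> (nat \<Rightarrow> bool) set" where
  "cantor_basis i = (case prod_decode i of (n, a) \<Rightarrow> {x. \<forall>k<n. x k \<longleftrightarrow> k \<in> set_decode a})"

definition theta :: "nat set \<Rightarrow> nat \<Rightarrow> bool" where
  "theta X = (\<lambda>n. n \<in> X)"

lemma bij_theta: "bij theta"
  by (rule bij_betw_byWitness[where f' = Collect]) (auto simp: theta_def)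

definition Pfin :: "nat set set" where
  "Pfin = {X. finite X}"


section \<open>Boldface and lightface classes\<close>

definition Sigma01 :: "'a topology \<Rightarrow> 'a set set" where
  "Sigma01 T = {S. openin T S}"

definition Pi01 :: "'a topology \<Rightarrow> 'a set set" where
  "Pi01 T = {S. closedin T S}"

definition Sigma02 :: "'a topology \<Rightarrow> 'a set set" where
  "Sigma02 T = {S. \<exists>U V :: nat \<Rightarrow> 'a set.
     (\<forall>n. openin T (U n) \<and> openin T (V n)) \<and> S = (\<Union>n. U n - V n)}"

definition Pi02 :: "'a topology \<Rightarrow> 'a set set" where
  "Pi02 T = {topspace T - S | S. S \<in> Sigma02 T}"

text \<open>
  The lightface classes depend on the presentation only, whose underlying space is always the whole
  type here. In \<open>eff_Sigma02\<close> the sections of the c.e. relations \<open>P\<close> and \<open>Q\<close> are the uniformly c.e.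
  index sets.
\<close>

definition eff_Sigma01 :: "(nat \<Rightarrow> 'a set) \<Rightarrow> 'a set set" where
  "eff_Sigma01 b = {S. \<exists>W. ce W \<and> S = (\<Union>i\<in>W. b i)}"

definition eff_Pi01 :: "(nat \<Rightarrow> 'a set) \<Rightarrow> 'a set set" where
  "eff_Pi01 b = {- S | S. S \<in> eff_Sigma01 b}"

definition eff_Sigma02 :: "(nat \<Rightarrow> 'a set) \<Rightarrow> 'a set set" where
  "eff_Sigma02 b = {S. \<exists>P Q. ce_rel P \<and> ce_rel Q \<and>
     S = (\<Union>n. (\<Union>i\<in>{i. (n, i) \<in> P}. b i) - (\<Union>i\<in>{i. (n, i) \<in> Q}. b i))}"


section \<open>Wadge reducibility, hardness and completeness\<close>

definition wadge_reducible :: "'a topology \<Rightarrow> 'a set \<Rightarrow> 'b topology \<Rightarrow> 'b set \<Rightarrow> bool" where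
  "wadge_reducible X S Y H \<longleftrightarrow>
     (\<exists>f. continuous_map X Y f \<and> S = {x \<in> topspace X. f x \<in> H})"

definition wadge_hard :: "'b topology \<Rightarrow> 'b set \<Rightarrow> 'a topology \<Rightarrow> 'a set set \<Rightarrow> bool" where
  "wadge_hard Y H X C \<longleftrightarrow> (\<forall>S\<in>C. wadge_reducible X S Y H)"

definition wadge_complete :: "'a topology \<Rightarrow> 'a set \<Rightarrow> 'a set set \<Rightarrow> bool" where
  "wadge_complete X H C \<longleftrightarrow> H \<in> C \<and> wadge_hard X H X C"

text \<open>
  For maps between the spaces \<open>scott\<close> and \<open>cantor\<close> with their standard presentations, the condition
  below says that the inverse images of basic open sets are c.e. open uniformly in the index (for
  \<open>cantor\<close> as the source this uses compactness of the cylinders).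
\<close>

definition eff_continuous ::
    "'a topology \<Rightarrow> (nat \<Rightarrow> 'a set) \<Rightarrow> 'b topology \<Rightarrow> (nat \<Rightarrow> 'b set) \<Rightarrow> ('a \<Rightarrow> 'b) \<Rightarrow> bool" where
  "eff_continuous X b Y c f \<longleftrightarrow> continuous_map X Y f \<and> ce_rel {(i, j). f ` b i \<subseteq> c j}"

definition eff_wadge_reducible ::
    "'a topology \<Rightarrow> (nat \<Rightarrow> 'a set) \<Rightarrow> 'a set \<Rightarrow> 'b topology \<Rightarrow> (nat \<Rightarrow> 'b set) \<Rightarrow> 'b set \<Rightarrow> bool" where
  "eff_wadge_reducible X b S Y c H \<longleftrightarrow>
     (\<exists>f. eff_continuous X b Y c f \<and> S = {x \<in> topspace X. f x \<in> H})"

definition eff_wadge_hard ::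
    "'b topology \<Rightarrow> (nat \<Rightarrow> 'b set) \<Rightarrow> 'b set \<Rightarrow> 'a topology \<Rightarrow> (nat \<Rightarrow> 'a set) \<Rightarrow> 'a set set \<Rightarrow> bool" where
  "eff_wadge_hard Y c H X b C \<longleftrightarrow> (\<forall>S\<in>C. eff_wadge_reducible X b S Y c H)"

definition eff_wadge_complete ::
    "'a topology \<Rightarrow> (nat \<Rightarrow> 'a set) \<Rightarrow> 'a set \<Rightarrow> 'a set set \<Rightarrow> bool" where
  "eff_wadge_complete X b H C \<longleftrightarrow> H \<in> C \<and> eff_wadge_hard X b H X b C"

text \<open>
  A constant map reduces the whole space to any nonempty family. Statements that no nonempty open
  family reduces to \<^const>\<open>Pfin\<close> therefore have to exclude the improper family \<^const>\<open>UNIV\<close>.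
\<close>

lemma UNIV_wadge_reducible_Pfin: "wadge_reducible scott UNIV scott Pfin"
proof -
  have top: "topspace scott = UNIV"
    by (auto simp: scott_def scott_base_def)
  then have "continuous_map scott scott (\<lambda>_. {})"
    by simp
  with top show ?thesis
    unfolding wadge_reducible_def Pfin_def by (intro exI[of _ "\<lambda>_. {}"]) simp
qed

end

theory Submission
  imports Defs
begin

text \<open>
  Write a \<open>\<Sigma>\<^sup>0\<^sub>2\<close> subset of the Cantor space as a union of pieces \<open>m\<close>, each a cylinder minus an open
  set; a point outside the union is seen to be outside each piece at some finite stage. Send \<open>x\<close> to
  the set of codes of pairs \<open>(j, s)\<close> such that \<open>s\<close> is the first stage at which \<open>x\<close> has been seen to be
  outside all pieces \<open>m \<le> j\<close>. That set has at most one element for each \<open>j\<close>, so it is finite iff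
  \<open>x\<close> lies in some piece. The \<open>k\<close>-th bit of the image depends on the first \<open>k\<close> bits of \<open>x\<close> only, so
  effectivity is a finite check. By Baire category, the family of infinite sets is not
  \<open>\<Sigma>\<^sup>0\<^sub>2\<close> in the Cantor space, and hence not in the coarser Scott topology.

  On the negative side, Scott continuous maps are monotone. Therefore a reduction of a proper
  open family sends the empty set to an infinite set, and all other sets to infinite sets as well.
\<close>

section \<open>Computable functions and decidable predicates\<close>

lemma total_rec_comp1:
  assumes "total_rec 1 f" "total_rec n g"
  shows "total_rec n (\<lambda>xs. f [g xs])"
  using total_rec.comp[OF assms(1), of "[g]" n] assms(2) by simp

lemma total_rec_comp2:
  assumes "total_rec 2 f" "total_rec n g" "total_rec n h"
  shows "total_rec n (\<lambda>xs. f [g xs, h xs])"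
  using total_rec.comp[OF assms(1), of "[g, h]" n] assms(2,3) by simp

lemma total_rec_Suc:
  assumes "total_rec n f"
  shows "total_rec n (\<lambda>xs. Suc (f xs))"
  using total_rec_comp1[OF total_rec.succ assms] by simp

lemma total_rec_const: "total_rec n (\<lambda>xs. c)"
  by (induction c) (auto intro: total_rec.zero total_rec_Suc)

text \<open>Pattern of the arithmetic closure lemmas: \<open>prec\<close> yields the operation on a
  short argument list, and the given functions are then substituted. In the step function, positions
  0 and 1 hold the recursion variable and the previous value.\<close>

lemma total_rec_add:
  assumes "total_rec n f" "total_rec n g"
  shows "total_rec n (\<lambda>xs. f xs + g xs)"
proof -
  have rec: "rec_nat b (\<lambda>k r. Suc r) a = a + b" for a b :: nat
    by (induction a) auto
  have "total_rec (Suc 1) (\<lambda>xs. rec_nat (tl xs ! 0) (\<lambda>k r. Suc ((k # r # tl xs) ! 1)) (hd xs))"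
    by (intro total_rec.prec total_rec_Suc total_rec.proj) auto
  from total_rec_comp2[OF this[unfolded Suc_1] assms]
  show ?thesis by (simp add: rec)
qed

lemma total_rec_mult:
  assumes "total_rec n f" "total_rec n g"
  shows "total_rec n (\<lambda>xs. f xs * g xs)"
proof -
  have rec: "rec_nat 0 (\<lambda>k r. r + b) a = a * b" for a b :: nat
    by (induction a) auto
  have "total_rec (Suc 1) (\<lambda>xs. rec_nat ((\<lambda>xs. 0) (tl xs))
      (\<lambda>k r. (k # r # tl xs) ! 1 + (k # r # tl xs) ! 2) (hd xs))"
    by (intro total_rec.prec total_rec_add total_rec.proj total_rec.zero) auto
  from total_rec_comp2[OF this[unfolded Suc_1] assms]
  show ?thesis by (simp add: rec)
qed

lemma total_rec_pred:
  assumes "total_rec n f"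
  shows "total_rec n (\<lambda>xs. f xs - 1)"
proof -
  have rec: "rec_nat 0 (\<lambda>k r. k) a = a - 1" for a :: nat
    by (cases a) auto
  have "total_rec (Suc 0) (\<lambda>xs. rec_nat ((\<lambda>xs. 0) (tl xs)) (\<lambda>k r. (k # r # tl xs) ! 0) (hd xs))"
    by (intro total_rec.prec total_rec.proj total_rec.zero) auto
  from total_rec_comp1[OF this[folded One_nat_def] assms]
  show ?thesis by (simp add: rec)
qed

lemma total_rec_diff:
  assumes "total_rec n f" "total_rec n g"
  shows "total_rec n (\<lambda>xs. f xs - g xs)"
proof -
  have rec: "rec_nat a (\<lambda>k r. r - 1) b = a - b" for a b :: nat
    by (induction b) auto
  have "total_rec (Suc 1) (\<lambda>xs. rec_nat (tl xs ! 0) (\<lambda>k r. (k # r # tl xs) ! 1 - 1) (hd xs))"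
    by (intro total_rec.prec total_rec_pred total_rec.proj) auto
  \<comment> \<open>The recursion runs on the subtrahend, so the two arguments are substituted in
    reverse order.\<close>
  from total_rec_comp2[OF this[unfolded Suc_1] assms(2,1)] rec
  show ?thesis by simp
qed

lemma total_rec_triangle:
  assumes "total_rec n f"
  shows "total_rec n (\<lambda>xs. triangle (f xs))"
proof -
  have rec: "rec_nat 0 (\<lambda>k r. r + Suc k) a = triangle a" for a :: nat
    by (induction a) auto
  have "total_rec (Suc 0) (\<lambda>xs. rec_nat ((\<lambda>xs. 0) (tl xs))
      (\<lambda>k r. (k # r # tl xs) ! 1 + Suc ((k # r # tl xs) ! 0)) (hd xs))"
    by (intro total_rec.prec total_rec.proj total_rec.zero total_rec_add total_rec_Suc) auto
  from total_rec_comp1[OF this[folded One_nat_def] assms] rec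
  show ?thesis by simp
qed

lemma total_rec_power2:
  assumes "total_rec n f"
  shows "total_rec n (\<lambda>xs. 2 ^ f xs)"
proof -
  have rec: "rec_nat 1 (\<lambda>k r. r + r) a = (2 :: nat) ^ a" for a
    by (induction a) auto
  have "total_rec (Suc 0) (\<lambda>xs. rec_nat ((\<lambda>xs. 1) (tl xs))
      (\<lambda>k r. (k # r # tl xs) ! 1 + (k # r # tl xs) ! 1) (hd xs))"
    by (intro total_rec.prec total_rec.proj total_rec_const total_rec_add) auto
  from total_rec_comp1[OF this[folded One_nat_def] assms] rec
  show ?thesis by simp
qed

lemma total_rec_prod_encode:
  assumes "total_rec n f" "total_rec n g"
  shows "total_rec n (\<lambda>xs. prod_encode (f xs, g xs))"
  unfolding prod_encode_def by (simp add: assms total_rec_add total_rec_triangle)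

definition pfst :: "nat \<Rightarrow> nat" where "pfst z = fst (prod_decode z)"
definition psnd :: "nat \<Rightarrow> nat" where "psnd z = snd (prod_decode z)"

lemma pfst_encode [simp]: "pfst (prod_encode (a, b)) = a"
  and psnd_encode [simp]: "psnd (prod_encode (a, b)) = b"
  by (simp_all add: pfst_def psnd_def)

lemma prod_encode_pfst_psnd [simp]: "prod_encode (pfst z, psnd z) = z"
  by (simp add: pfst_def psnd_def)

lemma pfst_le: "pfst z \<le> z"
  using le_prod_encode_1[of "pfst z" "psnd z"] by simp

lemma psnd_le: "psnd z \<le> z"
  using le_prod_encode_2[of "psnd z" "pfst z"] by simp

text \<open>The code of \<open>(a, b)\<close> is \<open>triangle (a + b) + a\<close> with
  \<open>a \<le> a + b\<close>, so the diagonal \<open>a + b\<close> is the first \<open>y\<close>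
  with \<open>z < triangle (Suc y)\<close>. Truncated subtraction puts this inequality into the form
  required by \<open>minimize\<close>.\<close>

lemma pfst_add_psnd: "pfst z + psnd z = (LEAST y. Suc z - triangle (Suc y) = 0)"
proof -
  define w where "w = pfst z + psnd z"
  have z: "z = triangle w + pfst z"
    using prod_encode_pfst_psnd[of z] by (simp add: prod_encode_def w_def)
  have "mono triangle"
    by (rule monoI) (simp only: triangle_def div_le_mono mult_le_mono Suc_le_mono)
  have "w \<le> y" if "Suc z - triangle (Suc y) = 0" for y
  proof (rule ccontr)
    assume "\<not> w \<le> y"
    with \<open>mono triangle\<close> have "triangle (Suc y) \<le> triangle w"
      by (intro monoD[of triangle]) auto
    with that z show False
      by linarith
  qed
  moreover have "Suc z - triangle (Suc w) = 0"
    using z by (simp add: w_def)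
  ultimately have "(LEAST y. Suc z - triangle (Suc y) = 0) = w"
    by (intro Least_equality) auto
  then show ?thesis by (simp add: w_def)
qed

lemma total_rec_pfst_add_psnd:
  assumes "total_rec n f"
  shows "total_rec n (\<lambda>xs. pfst (f xs) + psnd (f xs))"
proof -
  have "total_rec 1 (\<lambda>xs. LEAST y. Suc ((y # xs) ! 1) - triangle (Suc ((y # xs) ! 0)) = 0)"
  proof (intro total_rec.minimize allI impI)
    fix xs :: "nat list"
    \<comment> \<open>Regularity: the argument itself is a successful search value, since
      \<open>Suc z \<le> triangle (Suc z)\<close>.\<close>
    have "Suc ((xs ! 0 # xs) ! 1) - triangle (Suc ((xs ! 0 # xs) ! 0)) = 0"
      by simp
    then show "\<exists>y. Suc ((y # xs) ! 1) - triangle (Suc ((y # xs) ! 0)) = 0" by blast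
    show "total_rec (Suc 1) (\<lambda>xs. Suc (xs ! 1) - triangle (Suc (xs ! 0)))"
      by (intro total_rec_diff total_rec_Suc total_rec_triangle total_rec.proj) simp_all
  qed
  from total_rec_comp1[OF this assms] show ?thesis
    by (simp add: pfst_add_psnd)
qed

lemma total_rec_pfst:
  assumes "total_rec n f"
  shows "total_rec n (\<lambda>xs. pfst (f xs))"
proof -
  have "pfst z = z - triangle (pfst z + psnd z)" for z
    using prod_encode_pfst_psnd[of z] unfolding prod_encode_def by simp
  then have "(\<lambda>xs. pfst (f xs)) = (\<lambda>xs. f xs - triangle (pfst (f xs) + psnd (f xs)))"
    by blast
  with assms show ?thesis
    by (simp only: total_rec_diff total_rec_triangle total_rec_pfst_add_psnd)
qed

lemma total_rec_psnd:
  assumes "total_rec n f"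
  shows "total_rec n (\<lambda>xs. psnd (f xs))"
  using total_rec_diff[OF total_rec_pfst_add_psnd[OF assms] total_rec_pfst[OF assms]] by simp

lemma total_rec_computable:
  assumes "computable f" "total_rec n g"
  shows "total_rec n (\<lambda>xs. f (g xs))"
  using assms total_rec_comp1 unfolding computable_def by fastforce

lemma computable_total_rec: "computable f \<longleftrightarrow> total_rec 1 (\<lambda>xs. f (xs ! 0))"
proof
  show "computable f \<Longrightarrow> total_rec 1 (\<lambda>xs. f (xs ! 0))"
    by (rule total_rec_computable) (auto intro: total_rec.proj)
  show "total_rec 1 (\<lambda>xs. f (xs ! 0)) \<Longrightarrow> computable f"
    unfolding computable_def by (intro exI[of _ "\<lambda>xs. f (xs ! 0)"]) simp
qed

section \<open>Decidable predicates and bounded quantifiers\<close>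

definition dec :: "(nat \<Rightarrow> bool) \<Rightarrow> bool" where
  "dec P \<longleftrightarrow> computable (\<lambda>x. of_bool (P x))"

lemma computable_comp: "computable f \<Longrightarrow> computable g \<Longrightarrow> computable (\<lambda>x. f (g x))"
  unfolding computable_total_rec[of g] computable_total_rec[of "\<lambda>x. f (g x)"]
  by (rule total_rec_computable)

lemma dec_comp: "dec P \<Longrightarrow> computable g \<Longrightarrow> dec (\<lambda>x. P (g x))"
  unfolding dec_def by (rule computable_comp)

lemma computable_id: "computable (\<lambda>x. x)"
  by (simp add: computable_total_rec total_rec.proj)

lemma computable_const: "computable (\<lambda>x. c)"
  by (simp add: computable_total_rec total_rec_const)

lemma computable_Suc: "computable f \<Longrightarrow> computable (\<lambda>x. Suc (f x))"
  by (simp add: computable_total_rec total_rec_Suc)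

lemma computable_add: "computable f \<Longrightarrow> computable g \<Longrightarrow> computable (\<lambda>x. f x + g x)"
  by (simp add: computable_total_rec total_rec_add)

lemma computable_mult: "computable f \<Longrightarrow> computable g \<Longrightarrow> computable (\<lambda>x. f x * g x)"
  by (simp add: computable_total_rec total_rec_mult)

lemma computable_diff: "computable f \<Longrightarrow> computable g \<Longrightarrow> computable (\<lambda>x. f x - g x)"
  by (simp add: computable_total_rec total_rec_diff)

lemma computable_power2: "computable f \<Longrightarrow> computable (\<lambda>x. 2 ^ f x)"
  by (simp add: computable_total_rec total_rec_power2)

lemma computable_prod_encode:
  "computable f \<Longrightarrow> computable g \<Longrightarrow> computable (\<lambda>x. prod_encode (f x, g x))"
  by (simp add: computable_total_rec total_rec_prod_encode)

lemma computable_pfst: "computable f \<Longrightarrow> computable (\<lambda>x. pfst (f x))"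
  by (simp add: computable_total_rec total_rec_pfst)

lemma computable_psnd: "computable f \<Longrightarrow> computable (\<lambda>x. psnd (f x))"
  by (simp add: computable_total_rec total_rec_psnd)

lemma dec_not: "dec P \<Longrightarrow> dec (\<lambda>x. \<not> P x)"
proof -
  have "of_bool (\<not> b) = (1 :: nat) - of_bool b" for b
    by simp
  then show "dec P \<Longrightarrow> dec (\<lambda>x. \<not> P x)"
    unfolding dec_def by (simp only:) (intro computable_diff computable_const)
qed

lemma dec_conj: "dec P \<Longrightarrow> dec Q \<Longrightarrow> dec (\<lambda>x. P x \<and> Q x)"
  unfolding dec_def of_bool_conj by (intro computable_mult)

lemma dec_disj: "dec P \<Longrightarrow> dec Q \<Longrightarrow> dec (\<lambda>x. P x \<or> Q x)"
  using dec_not[OF dec_conj[OF dec_not dec_not]] by simp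

lemma dec_imp: "dec P \<Longrightarrow> dec Q \<Longrightarrow> dec (\<lambda>x. P x \<longrightarrow> Q x)"
  unfolding imp_conv_disj by (intro dec_disj dec_not)

lemma dec_iff: "dec P \<Longrightarrow> dec Q \<Longrightarrow> dec (\<lambda>x. P x \<longleftrightarrow> Q x)"
  unfolding iff_conv_conj_imp by (intro dec_conj dec_imp)

lemma dec_le:
  assumes "computable f" "computable g"
  shows "dec (\<lambda>x. f x \<le> g x)"
proof -
  have "of_bool (a \<le> b) = 1 - (a - b)" for a b :: nat
    by (cases "a \<le> b") simp_all
  with assms show ?thesis
    unfolding dec_def by (simp only:) (intro computable_diff computable_const)
qed

lemma dec_less: "computable f \<Longrightarrow> computable g \<Longrightarrow> dec (\<lambda>x. f x < g x)"
  unfolding Suc_le_eq[symmetric] by (intro dec_le computable_Suc)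

lemma dec_eq: "computable f \<Longrightarrow> computable g \<Longrightarrow> dec (\<lambda>x. f x = (g x :: nat))"
  unfolding order.eq_iff[where 'a = nat] by (intro dec_conj dec_le)

text \<open>Since \<open>dec\<close> is unary, the binary predicate is passed through pair codes.
  \<open>minimize\<close> searches for a zero, hence one minus the characteristic value.\<close>

lemma computable_Least:
  assumes P: "dec (\<lambda>w. P (pfst w) (psnd w))" and ex: "\<And>x. \<exists>y. P x y"
  shows "computable (\<lambda>x. LEAST y. P x y)"
proof -
  have "(1 :: nat) - of_bool (P x y) = 0 \<longleftrightarrow> P x y" for x y
    by simp
  moreover have "total_rec 1 (\<lambda>xs. LEAST y.
      1 - of_bool (P (pfst (prod_encode ((y # xs) ! 1, (y # xs) ! 0)))
        (psnd (prod_encode ((y # xs) ! 1, (y # xs) ! 0)))) = (0 :: nat))"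
  proof (intro total_rec.minimize allI impI)
    show "total_rec (Suc 1) (\<lambda>xs. 1 - of_bool (P (pfst (prod_encode (xs ! 1, xs ! 0)))
        (psnd (prod_encode (xs ! 1, xs ! 0)))))"
      using total_rec_diff[OF total_rec_const total_rec_computable[OF P[unfolded dec_def]
          total_rec_prod_encode[OF total_rec.proj[of 1] total_rec.proj[of 0]]]]
      by simp
  qed (use ex in simp)
  ultimately show ?thesis
    unfolding computable_total_rec pfst_encode psnd_encode by simp
qed

text \<open>Search for the first counterexample, with the bound itself as a stopping point: the
  quantifier holds iff the search does not stop earlier.\<close>

lemma dec_all_less:
  assumes "computable b" "dec (\<lambda>w. P (pfst w) (psnd w))"
  shows "dec (\<lambda>x. \<forall>y<b x. P x y)"
proof -
  have "(\<forall>y<b x. P x y) \<longleftrightarrow> b x \<le> (LEAST y. b x \<le> y \<or> \<not> P x y)" for x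
  proof
    assume all: "\<forall>y<b x. P x y"
    have "b x \<le> (LEAST y. b x \<le> y \<or> \<not> P x y) \<or> \<not> P x (LEAST y. b x \<le> y \<or> \<not> P x y)"
      by (rule LeastI[of _ "b x"]) simp
    with all show "b x \<le> (LEAST y. b x \<le> y \<or> \<not> P x y)"
      by (meson not_le)
  next
    assume "b x \<le> (LEAST y. b x \<le> y \<or> \<not> P x y)"
    then show "\<forall>y<b x. P x y"
      using not_less_Least order.strict_trans2 by blast
  qed
  moreover have "computable (\<lambda>x. LEAST y. b x \<le> y \<or> \<not> P x y)"
    by (intro computable_Least dec_disj dec_not dec_le assms computable_comp[OF assms(1)]
        computable_pfst computable_psnd computable_id) auto
  ultimately show ?thesis
    using dec_le[OF assms(1)] by simp
qed

lemma dec_ex_less: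
  assumes "computable b" "dec (\<lambda>w. P (pfst w) (psnd w))"
  shows "dec (\<lambda>x. \<exists>y<b x. P x y)"
  using dec_not[OF dec_all_less[OF assms(1) dec_not[OF assms(2)]]] by simp

lemma dec_all_le:
  assumes "computable b" "dec (\<lambda>w. P (pfst w) (psnd w))"
  shows "dec (\<lambda>x. \<forall>y\<le>b x. P x y)"
  using dec_all_less[OF computable_Suc[OF assms(1)] assms(2)] by (simp add: less_Suc_eq_le)

lemma dec_ex_le:
  assumes "computable b" "dec (\<lambda>w. P (pfst w) (psnd w))"
  shows "dec (\<lambda>x. \<exists>y\<le>b x. P x y)"
  using dec_ex_less[OF computable_Suc[OF assms(1)] assms(2)] by (simp add: less_Suc_eq_le)

text \<open>Bit \<open>k\<close> of \<open>a\<close> is set iff \<open>a div 2 ^ k\<close> has the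
  form \<open>2 * q + 1\<close>. Expressing the quotient by two inequalities with
  \<open>q \<le> a\<close> leaves a bounded search without division.\<close>

lemma dec_set_decode:
  assumes "computable f" "computable g"
  shows "dec (\<lambda>x. f x \<in> set_decode (g x))"
proof -
  have "k \<in> set_decode a \<longleftrightarrow> (\<exists>q\<le>a. (2 * q + 1) * 2 ^ k \<le> a \<and> a < (2 * q + 2) * 2 ^ k)" for k a
  proof -
    have "a div 2 ^ k = d \<longleftrightarrow> d * 2 ^ k \<le> a \<and> a < Suc d * 2 ^ k" for d :: nat
      using less_eq_div_iff_mult_less_eq[of "2 ^ k" d a] div_less_iff_less_mult[of "2 ^ k" a "Suc d"]
      by auto
    moreover have "odd (a div 2 ^ k) \<longleftrightarrow> (\<exists>q\<le>a. a div 2 ^ k = 2 * q + 1)"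
    proof
      assume "odd (a div 2 ^ k)"
      then obtain q where q: "a div 2 ^ k = 2 * q + 1"
        by (rule oddE)
      moreover have "a div 2 ^ k \<le> a"
        by simp
      ultimately have "q \<le> a"
        by linarith
      with q show "\<exists>q\<le>a. a div 2 ^ k = 2 * q + 1" by blast
    qed auto
    ultimately show ?thesis
      by (simp add: set_decode_def)
  qed
  with assms show ?thesis
    by (simp only:) (intro dec_ex_le dec_conj dec_le dec_less computable_mult computable_add
        computable_power2 computable_const computable_comp[OF assms(1)]
        computable_comp[OF assms(2)] computable_pfst computable_psnd computable_id)
qed

lemmas dec_intros = computable_id computable_const computable_Suc computable_add computable_mult
  computable_diff computable_power2 computable_prod_encode computable_pfst computable_psnd
  dec_not dec_conj dec_disj dec_imp dec_iff dec_le dec_less dec_eq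
  dec_all_less dec_ex_less dec_all_le dec_ex_le dec_set_decode

section \<open>Computably enumerable sets as projections of decidable sets\<close>

lemma ce_iff_dec: "ce W \<longleftrightarrow> (\<exists>D. dec D \<and> W = {x. \<exists>y. D (prod_encode (x, y))})"
proof
  assume "ce W"
  then consider "W = {}" | h where "computable h" "W = range h"
    unfolding ce_def by blast
  then show "\<exists>D. dec D \<and> W = {x. \<exists>y. D (prod_encode (x, y))}"
  proof cases
    case 1
    then show ?thesis
      by (intro exI[of _ "\<lambda>_. False"]) (simp add: dec_def computable_const)
  next
    case 2
    then show ?thesis
      by (intro exI[of _ "\<lambda>z. pfst z = h (psnd z)"])
        (auto intro!: dec_intros computable_comp[OF 2(1)])
  qed
next
  assume "\<exists>D. dec D \<and> W = {x. \<exists>y. D (prod_encode (x, y))}"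
  then obtain D where D: "dec D" and W: "W = {x. \<exists>y. D (prod_encode (x, y))}"
    by blast
  show "ce W"
  proof (cases "W = {}")
    case False
    then obtain a where a: "a \<in> W" by blast
    \<comment> \<open>Codes of pairs accepted by \<open>D\<close> are sent to their first component,
      all others to the fixed member \<open>a\<close>, so that \<open>h\<close> is total with range
      \<open>W\<close>.\<close>
    define h where "h = (\<lambda>z. of_bool (D z) * pfst z + (1 - of_bool (D z)) * a)"
    have "computable h"
      unfolding h_def by (intro dec_intros D[unfolded dec_def])
    moreover have "range h = W"
    proof
      show "range h \<subseteq> W"
      proof
        fix x assume "x \<in> range h"
        then obtain z where "x = h z" by blast
        moreover have "pfst z \<in> W" if "D z"
          using that unfolding W by (intro CollectI exI[of _ "psnd z"]) simp
        ultimately show "x \<in> W"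
          using a by (cases "D z") (auto simp: h_def)
      qed
      show "W \<subseteq> range h"
      proof
        fix x assume "x \<in> W"
        then obtain y where "D (prod_encode (x, y))" using W by blast
        then have "x = h (prod_encode (x, y))" by (simp add: h_def)
        then show "x \<in> range h" by blast
      qed
    qed
    ultimately show ?thesis unfolding ce_def by blast
  qed (simp add: ce_def)
qed

text \<open>Regroups \<open>((n, i), t)\<close> as \<open>(n, (i, t))\<close>, so that index and
  stage together form one number attached to \<open>n\<close>.\<close>

lemma ce_rel_iff_dec:
  "ce_rel R \<longleftrightarrow> (\<exists>D. dec D \<and> R = {(n, i). \<exists>t. D (prod_encode (n, prod_encode (i, t)))})"
proof
  assume "ce_rel R"
  then obtain D where D: "dec D" and R: "prod_encode ` R = {x. \<exists>y. D (prod_encode (x, y))}"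
    unfolding ce_rel_def ce_iff_dec by blast
  let ?D = "\<lambda>z. D (prod_encode (prod_encode (pfst z, pfst (psnd z)), psnd (psnd z)))"
  have "dec ?D"
    by (intro dec_comp[OF D] dec_intros)
  moreover have "(n, i) \<in> R \<longleftrightarrow> prod_encode (n, i) \<in> prod_encode ` R" for n i
    by (auto simp: prod_encode_eq)
  then have "R = {(n, i). \<exists>t. ?D (prod_encode (n, prod_encode (i, t)))}"
    unfolding R by auto
  ultimately show "\<exists>D. dec D \<and> R = {(n, i). \<exists>t. D (prod_encode (n, prod_encode (i, t)))}"
    by blast
next
  assume "\<exists>D. dec D \<and> R = {(n, i). \<exists>t. D (prod_encode (n, prod_encode (i, t)))}"
  then obtain D where D: "dec D" and R: "R = {(n, i). \<exists>t. D (prod_encode (n, prod_encode (i, t)))}"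
    by blast
  let ?D = "\<lambda>z. D (prod_encode (pfst (pfst z), prod_encode (psnd (pfst z), psnd z)))"
  have "dec ?D"
    by (intro dec_comp[OF D] dec_intros)
  moreover have "x \<in> prod_encode ` R \<longleftrightarrow> (pfst x, psnd x) \<in> R" for x
    by (force simp: image_iff)
  then have "prod_encode ` R = {x. \<exists>y. ?D (prod_encode (x, y))}"
    unfolding R by auto
  ultimately show "ce_rel R"
    unfolding ce_rel_def ce_iff_dec by blast
qed

lemma ce_rel_dec:
  assumes "dec (\<lambda>z. R (pfst z) (psnd z))"
  shows "ce_rel {(i, j). R i j}"
proof -
  have "dec (\<lambda>z. R (pfst z) (pfst (psnd z)))"
    using dec_comp[OF assms, of "\<lambda>z. prod_encode (pfst z, pfst (psnd z))"]
    by (simp add: dec_intros)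
  then show ?thesis
    unfolding ce_rel_iff_dec by (intro exI[of _ "\<lambda>z. R (pfst z) (pfst (psnd z))"]) simp
qed

section \<open>Bounds on codes of finite sets and binary strings\<close>

lemma less_if_mem_set_decode: "k \<in> set_decode i \<Longrightarrow> k < i"
proof -
  assume "k \<in> set_decode i"
  then have "2 ^ k \<le> i"
    by (metis div_less even_zero not_le set_decode_def mem_Collect_eq)
  then show "k < i"
    using less_exp[of k] by linarith
qed

text \<open>Members of a coded set are smaller than its code; this turns inclusion into a bounded
  check.\<close>

lemma set_decode_subset_iff: "set_decode i \<subseteq> X \<longleftrightarrow> (\<forall>k<i. k \<in> set_decode i \<longrightarrow> k \<in> X)"
  using less_if_mem_set_decode by blast

text \<open>Makes quantification over all binary strings of length \<open>n\<close> a bounded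
  quantification over codes.\<close>

lemma ex_code_less: "\<exists>a<2 ^ n. \<forall>k<n. k \<in> set_decode a \<longleftrightarrow> x k"
proof (intro exI conjI)
  let ?A = "{k. k < n \<and> x k}"
  have "set_encode ?A \<le> sum ((^) 2) {0..<n}"
    unfolding set_encode_def by (rule sum_mono2) auto
  also have "\<dots> < 2 ^ n"
    by (simp add: sum_power2)
  finally show "set_encode ?A < 2 ^ n" .
  show "\<forall>k<n. k \<in> set_decode (set_encode ?A) \<longleftrightarrow> x k"
    by simp
qed

section \<open>The Cantor space and the Scott topology\<close>

lemma topspace_cantor [simp]: "topspace cantor = UNIV"
  by (simp add: cantor_def)

lemma mem_cantor_basis: "x \<in> cantor_basis i \<longleftrightarrow> (\<forall>k<pfst i. x k \<longleftrightarrow> k \<in> set_decode (psnd i))"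
  by (simp add: cantor_basis_def pfst_def psnd_def split: prod.split)

lemma cantor_basis_0 [simp]: "cantor_basis 0 = UNIV"
  using pfst_le[of 0] by (auto simp: mem_cantor_basis)

text \<open>Cylinder \<open>i\<close> fixes \<open>pfst i\<close> bits, and
  \<open>pfst i \<le> i\<close>. The crude length \<open>i\<close> is what later arguments
  use.\<close>

lemma cantor_basis_cong:
  assumes "\<And>k. k < n \<Longrightarrow> x k = y k" "i \<le> n"
  shows "x \<in> cantor_basis i \<longleftrightarrow> y \<in> cantor_basis i"
  using assms pfst_le[of i] by (simp add: mem_cantor_basis)

lemma cantor_neighbourhood:
  obtains i where "x \<in> cantor_basis i" "\<And>y k. y \<in> cantor_basis i \<Longrightarrow> k < n \<Longrightarrow> y k = x k"
proof -
  obtain a where "\<forall>k<n. k \<in> set_decode a \<longleftrightarrow> x k"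
    using ex_code_less by blast
  then show ?thesis
    by (intro that[of "prod_encode (n, a)"]) (auto simp: mem_cantor_basis)
qed

text \<open>A basic open set of the product restricts finitely many coordinates and so contains a
  cylinder around each of its points; conversely a cylinder is a product of finitely many singletons
  with full factors.\<close>

lemma openin_cantor: "openin cantor S \<longleftrightarrow> (\<forall>x\<in>S. \<exists>i. x \<in> cantor_basis i \<and> cantor_basis i \<subseteq> S)"
proof
  assume S: "openin cantor S"
  show "\<forall>x\<in>S. \<exists>i. x \<in> cantor_basis i \<and> cantor_basis i \<subseteq> S"
  proof
    fix x assume "x \<in> S"
    with S obtain U :: "nat \<Rightarrow> bool set"
      where fin: "finite {k. U k \<noteq> UNIV}" and x: "x \<in> Pi\<^sub>E UNIV U" and sub: "Pi\<^sub>E UNIV U \<subseteq> S"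
      unfolding cantor_def openin_product_topology_alt by auto
    from fin obtain n where n: "k < n" if "U k \<noteq> UNIV" for k
      unfolding finite_nat_set_iff_bounded by auto
    obtain i where i: "x \<in> cantor_basis i" "\<And>y k. y \<in> cantor_basis i \<Longrightarrow> k < n \<Longrightarrow> y k = x k"
      using cantor_neighbourhood[of x n] by blast
    have "y k \<in> U k" if "y \<in> cantor_basis i" for y k
      using i(2)[OF that, of k] n[of k] x by (cases "U k = UNIV") auto
    then have "cantor_basis i \<subseteq> Pi\<^sub>E UNIV U"
      by auto
    with i(1) sub show "\<exists>i. x \<in> cantor_basis i \<and> cantor_basis i \<subseteq> S"
      by blast
  qed
next
  assume S: "\<forall>x\<in>S. \<exists>i. x \<in> cantor_basis i \<and> cantor_basis i \<subseteq> S"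
  show "openin cantor S"
    unfolding cantor_def openin_product_topology_alt
  proof
    fix x assume "x \<in> S"
    with S obtain i where i: "x \<in> cantor_basis i" "cantor_basis i \<subseteq> S" by blast
    let ?U = "\<lambda>k. if k < pfst i then {x k} else UNIV"
    have "finite {k. ?U k \<noteq> UNIV}"
      by (rule finite_subset[of _ "{..<pfst i}"]) auto
    moreover have "Pi\<^sub>E UNIV ?U \<subseteq> cantor_basis i"
    proof
      fix y assume "y \<in> Pi\<^sub>E UNIV ?U"
      then have "y k \<in> ?U k" for k by (rule PiE_mem) simp
      then have "y k = x k" if "k < pfst i" for k
        using that by (metis singletonD)
      with i(1) show "y \<in> cantor_basis i"
        by (simp add: mem_cantor_basis)
    qed
    ultimately show "\<exists>U. finite {i \<in> UNIV. U i \<noteq> topspace (discrete_topology UNIV)} \<and>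
        (\<forall>i\<in>UNIV. openin (discrete_topology UNIV) (U i)) \<and> x \<in> Pi\<^sub>E UNIV U \<and> Pi\<^sub>E UNIV U \<subseteq> S"
      using i(2) by (intro exI[of _ ?U]) auto
  qed
qed

lemma openin_cantor_basis: "openin cantor (cantor_basis i)"
  by (auto simp: openin_cantor)

section \<open>The Scott topology and its continuous maps\<close>

lemma topspace_scott [simp]: "topspace scott = UNIV"
  by (auto simp: scott_def scott_base_def)

text \<open>The generating sets already form a basis: the intersection of
  \<open>scott_base A\<close> and \<open>scott_base B\<close> is
  \<open>scott_base (A \<union> B)\<close>, which settles the only nontrivial case of the
  induction.\<close>

lemma openin_scott: "openin scott U \<longleftrightarrow> (\<forall>X\<in>U. \<exists>A. finite A \<and> A \<subseteq> X \<and> scott_base A \<subseteq> U)"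
proof
  assume "openin scott U"
  then have "generate_topology_on {scott_base A | A. finite A} U"
    by (simp add: scott_def openin_topology_generated_by_iff)
  then show "\<forall>X\<in>U. \<exists>A. finite A \<and> A \<subseteq> X \<and> scott_base A \<subseteq> U"
  proof induction
    case (Int U V)
    show ?case
    proof
      fix X assume X: "X \<in> U \<inter> V"
      with Int.IH obtain A B where "finite A" "A \<subseteq> X" "scott_base A \<subseteq> U"
        "finite B" "B \<subseteq> X" "scott_base B \<subseteq> V"
        by (meson IntD1 IntD2)
      then show "\<exists>A. finite A \<and> A \<subseteq> X \<and> scott_base A \<subseteq> U \<inter> V"
        by (intro exI[of _ "A \<union> B"]) (auto simp: scott_base_def)
    qed
  next
    case (UN K)
    then show ?case
      by (meson Union_iff Union_upper order_trans)
  next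
    case (Basis U)
    then show ?case
      by (auto simp: scott_base_def)
  qed simp
next
  assume U: "\<forall>X\<in>U. \<exists>A. finite A \<and> A \<subseteq> X \<and> scott_base A \<subseteq> U"
  have "U = \<Union>{scott_base A | A. finite A \<and> scott_base A \<subseteq> U}"
  proof
    show "U \<subseteq> \<Union>{scott_base A | A. finite A \<and> scott_base A \<subseteq> U}"
    proof
      fix X assume "X \<in> U"
      with U obtain A where "finite A" "A \<subseteq> X" "scott_base A \<subseteq> U" by blast
      moreover from \<open>A \<subseteq> X\<close> have "X \<in> scott_base A" by (simp add: scott_base_def)
      ultimately show "X \<in> \<Union>{scott_base A | A. finite A \<and> scott_base A \<subseteq> U}" by blast
    qed
  qed blast
  moreover have "openin scott (\<Union>{scott_base A | A. finite A \<and> scott_base A \<subseteq> U})"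
    by (intro openin_Union) (auto simp: scott_def intro: topology_generated_by_Basis)
  ultimately show "openin scott U"
    by simp
qed

lemma openin_scott_upward: "openin scott U \<Longrightarrow> X \<in> U \<Longrightarrow> X \<subseteq> Y \<Longrightarrow> Y \<in> U"
  unfolding openin_scott scott_base_def by blast

lemma openin_scott_basis: "openin scott (scott_basis i)"
  unfolding scott_basis_def scott_def by (rule topology_generated_by_Basis) auto

lemma openin_scott_mem: "openin scott {X. k \<in> X}"
  by (auto simp: openin_scott scott_base_def intro!: exI[of _ "{k}"])

lemma continuous_map_scottI:
  assumes "\<And>k. openin T {x \<in> topspace T. k \<in> f x}"
  shows "continuous_map T scott f"
  unfolding scott_def
proof (rule continuous_on_generated_topo)
  fix U assume "U \<in> {scott_base A | A. finite A}"
  then obtain A where A: "finite A" "U = scott_base A"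
    by blast
  \<comment> \<open>The extra factor \<open>topspace T\<close> matters for \<open>A = {}\<close>,
    where the intersection is \<open>UNIV\<close>.\<close>
  have "openin T ((\<Inter>k\<in>A. {x \<in> topspace T. k \<in> f x}) \<inter> topspace T)"
    using A(1) assms by (cases "A = {}") (auto intro!: openin_Int openin_INT)
  moreover have "f -` U \<inter> topspace T = (\<Inter>k\<in>A. {x \<in> topspace T. k \<in> f x}) \<inter> topspace T"
    using A(2) by (auto simp: scott_base_def)
  ultimately show "openin T (f -` U \<inter> topspace T)"
    by simp
next
  have "scott_base {} \<in> {scott_base A | A. finite A}" by blast
  moreover have "scott_base {} = UNIV" by (simp add: scott_base_def)
  ultimately show "f ` topspace T \<subseteq> \<Union>{scott_base A | A. finite A}" by blast
qed

text \<open>Scott open families are upward closed; apply this to the preimage of the open family of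
  all sets containing \<open>k\<close>.\<close>

lemma continuous_map_scott_mono:
  assumes "continuous_map scott scott f" "X \<subseteq> Y"
  shows "f X \<subseteq> f Y"
proof
  fix k assume "k \<in> f X"
  then have "X \<in> {Z \<in> topspace scott. f Z \<in> {W. k \<in> W}}"
    by simp
  with openin_scott_upward[OF openin_continuous_map_preimage[OF assms(1) openin_scott_mem] _ assms(2)]
  show "k \<in> f Y"
    by blast
qed

text \<open>\<open>Collect\<close> is the inverse of \<open>theta\<close>, so this says that the
  Scott topology is coarser than the Cantor topology.\<close>

lemma continuous_map_Collect: "continuous_map cantor scott Collect"
proof (rule continuous_map_scottI)
  fix k
  show "openin cantor {x \<in> topspace cantor. k \<in> Collect x}"
    unfolding openin_cantor
  proof
    fix x assume x: "x \<in> {x \<in> topspace cantor. k \<in> Collect x}"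
    obtain i where i: "x \<in> cantor_basis i"
        "\<And>y j. y \<in> cantor_basis i \<Longrightarrow> j < Suc k \<Longrightarrow> y j = x j"
      using cantor_neighbourhood[of x "Suc k"] by blast
    have "cantor_basis i \<subseteq> {x \<in> topspace cantor. k \<in> Collect x}"
      using x i(2)[of _ k] by auto
    with i(1) show "\<exists>i. x \<in> cantor_basis i \<and> cantor_basis i \<subseteq> {x \<in> topspace cantor. k \<in> Collect x}"
      by blast
  qed
qed

lemma theta_image: "theta ` \<S> = {x. Collect x \<in> \<S>}"
  by (force simp: theta_def)

lemma theta_Pfin: "theta ` Pfin = {x. finite {k. x k}}"
  by (simp add: theta_image Pfin_def)

section \<open>Second-level classes and the position of \<open>Pfin\<close> among them\<close>

lemma Sigma02I:
  assumes "\<And>n. openin T (U n)" "\<And>n. openin T (V n)" "S = (\<Union>n :: nat. U n - V n)"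
  shows "S \<in> Sigma02 T"
  unfolding Sigma02_def by (intro CollectI exI[of _ U] exI[of _ V] conjI allI assms)

lemma Sigma02E:
  assumes "S \<in> Sigma02 T"
  obtains U V :: "nat \<Rightarrow> _" where "\<forall>n. openin T (U n)" "\<forall>n. openin T (V n)"
    "S = (\<Union>n. U n - V n)"
proof -
  from assms obtain U V :: "nat \<Rightarrow> _"
    where "\<forall>n. openin T (U n) \<and> openin T (V n)" "S = (\<Union>n. U n - V n)"
    unfolding Sigma02_def by blast
  with that[of U V] show thesis by simp
qed

lemma Sigma02_preimage:
  assumes "continuous_map X Y f" "S \<in> Sigma02 Y"
  shows "{x \<in> topspace X. f x \<in> S} \<in> Sigma02 X"
proof -
  obtain U V :: "nat \<Rightarrow> _" where UV: "\<forall>n. openin Y (U n)" "\<forall>n. openin Y (V n)"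
    and S: "S = (\<Union>n. U n - V n)"
    using assms(2) by (rule Sigma02E)
  show ?thesis
    by (rule Sigma02I[OF openin_continuous_map_preimage[OF assms(1) UV(1)[rule_format]]
        openin_continuous_map_preimage[OF assms(1) UV(2)[rule_format]]]) (auto simp: S)
qed

lemma Pi02_preimage:
  assumes "continuous_map X Y f" "S \<in> Pi02 Y"
  shows "{x \<in> topspace X. f x \<in> S} \<in> Pi02 X"
proof -
  from assms(2) obtain R where R: "R \<in> Sigma02 Y" "S = topspace Y - R"
    unfolding Pi02_def by blast
  have "{x \<in> topspace X. f x \<in> S} = topspace X - {x \<in> topspace X. f x \<in> R}"
    using R(2) continuous_map_image_subset_topspace[OF assms(1)] by auto
  with Sigma02_preimage[OF assms(1) R(1)] show ?thesis
    unfolding Pi02_def by blast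
qed

lemma eff_Sigma01_subset:
  assumes "\<And>i. openin T (b i)"
  shows "eff_Sigma01 b \<subseteq> Sigma01 T"
  using assms by (auto simp: eff_Sigma01_def Sigma01_def)

lemma eff_Sigma02_subset:
  assumes "\<And>i. openin T (b i)"
  shows "eff_Sigma02 b \<subseteq> Sigma02 T"
proof
  fix S assume "S \<in> eff_Sigma02 b"
  then obtain P Q :: "(nat \<times> nat) set"
    where S: "S = (\<Union>n. (\<Union>i\<in>{i. (n, i) \<in> P}. b i) - (\<Union>i\<in>{i. (n, i) \<in> Q}. b i))"
    unfolding eff_Sigma02_def by blast
  have "openin T (\<Union>i\<in>I. b i)" for I
    using assms by (intro openin_Union) auto
  then show "S \<in> Sigma02 T"
    by (intro Sigma02I[OF _ _ S])
qed

lemma eff_wadge_reducible_imp: "eff_wadge_reducible X b S Y c H \<Longrightarrow> wadge_reducible X S Y H"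
  unfolding eff_wadge_reducible_def wadge_reducible_def eff_continuous_def by blast

text \<open>Otherwise the infinite sets form a countable union of closed sets, and adding a
  singleton for each finite set covers the Cantor space. Each closed set used has empty interior
  because finite and infinite sets are both dense, contradicting Baire.\<close>

lemma theta_Pfin_notin_Pi02: "theta ` Pfin \<notin> Pi02 cantor"
proof
  assume "theta ` Pfin \<in> Pi02 cantor"
  then obtain R where R: "R \<in> Sigma02 cantor" "{x. finite {k. x k}} = UNIV - R"
    unfolding Pi02_def theta_Pfin by auto
  from R(1) obtain U V :: "nat \<Rightarrow> (nat \<Rightarrow> bool) set"
    where UV: "\<forall>n. openin cantor (U n)" "\<forall>n. openin cantor (V n)"
    and "R = (\<Union>n. U n - V n)"
    by (rule Sigma02E)
  with R(2) have eq: "{x. finite {k. x k}} = UNIV - (\<Union>n. U n - V n)"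
    by simp
  \<comment> \<open>Cutting \<open>U n\<close> into clopen cylinders makes \<open>U n - V n\<close>
    a countable union of closed sets; cylinders not inside \<open>U n\<close> contribute the empty
    set.\<close>
  define C where "C = (\<lambda>n i. if cantor_basis i \<subseteq> U n then cantor_basis i - V n else {})"
  define \<G> where "\<G> = range (\<lambda>A. {theta (set_decode A)}) \<union> (\<Union>n. range (C n))"
  have haus: "Hausdorff_space cantor" and comp: "compact_space cantor"
    unfolding cantor_def
    by (simp_all add: Hausdorff_space_product_topology compact_space_product_topology compact_space_discrete_topology)
  have closed_basis: "closedin cantor (cantor_basis i)" for i
  proof -
    have "openin cantor (- cantor_basis i)"
      unfolding openin_cantor
    proof
      fix x assume x: "x \<in> - cantor_basis i"
      obtain j where j: "x \<in> cantor_basis j" "\<And>y k. y \<in> cantor_basis j \<Longrightarrow> k < i \<Longrightarrow> y k = x k"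
        using cantor_neighbourhood[of x i] by blast
      then have "cantor_basis j \<subseteq> - cantor_basis i"
        using x cantor_basis_cong[of i x _ i] by (metis ComplD ComplI order_refl subsetI)
      with j(1) show "\<exists>j. x \<in> cantor_basis j \<and> cantor_basis j \<subseteq> - cantor_basis i"
        by blast
    qed
    then show ?thesis
      by (simp add: closedin_def Compl_eq_Diff_UNIV)
  qed
  have finite_point: "\<exists>x\<in>W. finite {k. x k}" and infinite_point: "\<exists>x\<in>W. infinite {k. x k}"
    if "openin cantor W" "W \<noteq> {}" for W
  proof -
    from that obtain i where i: "cantor_basis i \<subseteq> W"
      unfolding openin_cantor by blast
    have "theta (set_decode (psnd i)) \<in> cantor_basis i"
      by (simp add: mem_cantor_basis theta_def)
    moreover have "finite {k. theta (set_decode (psnd i)) k}"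
      by (simp add: theta_def)
    ultimately show "\<exists>x\<in>W. finite {k. x k}"
      using i by blast
    \<comment> \<open>The bits fixed by the cylinder are kept and all later ones are set.\<close>
    let ?y = "\<lambda>k. k \<in> set_decode (psnd i) \<or> pfst i \<le> k"
    have "?y \<in> cantor_basis i"
      by (simp add: mem_cantor_basis)
    moreover have "infinite {k. ?y k}"
      using infinite_super[OF _ infinite_Ici[of "pfst i"], of "{k. ?y k}"] by auto
    ultimately show "\<exists>x\<in>W. infinite {k. x k}"
      using i by blast
  qed
  have "cantor interior_of \<Union>\<G> = {}"
  proof (rule Baire_category_alt)
    show "completely_metrizable_space cantor \<or> locally_compact_space cantor \<and> regular_space cantor"
      using haus comp compact_Hausdorff_imp_regular_space compact_imp_locally_compact_space by blast
    show "countable \<G>"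
      unfolding \<G>_def by auto
    fix T assume "T \<in> \<G>"
    then consider A where "T = {theta (set_decode A)}" | n i where "T = cantor_basis i - V n" "cantor_basis i \<subseteq> U n"
      | "T = {}"
      unfolding \<G>_def C_def by (auto split: if_splits)
    then show "closedin cantor T \<and> cantor interior_of T = {}"
    proof cases
      case (1 A)
      have "finite {k. x k}" if "x \<in> T" for x
        using 1 that by (simp add: theta_def)
      then have "cantor interior_of T = {}"
        using infinite_point[OF openin_interior_of] interior_of_subset by (metis subsetD)
      with 1 haus show ?thesis
        by (simp add: closedin_Hausdorff_sing_eq)
    next
      case (2 i n)
      have "infinite {k. x k}" if "x \<in> T" for x
        using 2 that eq by blast
      then have "cantor interior_of T = {}"
        using finite_point[OF openin_interior_of] interior_of_subset by (metis subsetD)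
      with 2 closed_basis UV(2) show ?thesis
        by (simp add: closedin_diff)
    qed simp
  qed
  moreover have "\<Union>\<G> = UNIV"
  proof -
    have "x \<in> \<Union>\<G>" for x
    proof (cases "finite {k. x k}")
      case True
      then have "x = theta (set_decode (set_encode {k. x k}))"
        by (simp add: theta_def)
      then show ?thesis
        unfolding \<G>_def by blast
    next
      case False
      with eq obtain n where n: "x \<in> U n - V n"
        by blast
      then obtain i where "x \<in> cantor_basis i" "cantor_basis i \<subseteq> U n"
        using UV(1) unfolding openin_cantor by blast
      with n have "x \<in> C n i"
        by (simp add: C_def)
      then show ?thesis
        unfolding \<G>_def by blast
    qed
    then show ?thesis by blast
  qed
  ultimately show False
    using interior_of_topspace[of cantor] by simp
qed

lemma in_eff_Sigma02I:
  assumes "dec p" "dec q"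
    "S = (\<Union>n. (\<Union>i\<in>{i. p (prod_encode (n, i))}. b i) - (\<Union>i\<in>{i. q (prod_encode (n, i))}. b i))"
  shows "S \<in> eff_Sigma02 b"
proof -
  have "ce_rel {(n, i). P (prod_encode (n, i))}" if "dec P" for P
    using that by (intro ce_rel_dec) simp
  with assms show ?thesis
    unfolding eff_Sigma02_def
    by (intro CollectI exI[of _ "{(n, i). p (prod_encode (n, i))}"]
        exI[of _ "{(n, i). q (prod_encode (n, i))}"]) simp
qed

text \<open>Finiteness means that some \<open>n\<close> bounds all members. Piece \<open>n\<close>
  is the whole space, given by index 0, minus the cylinders that force a member at some position
  \<open>k \<ge> n\<close>.\<close>

lemma theta_Pfin_eff_Sigma02: "theta ` Pfin \<in> eff_Sigma02 cantor_basis"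
proof (rule in_eff_Sigma02I)
  let ?p = "\<lambda>z. psnd z = 0"
  let ?q = "\<lambda>z. \<exists>k<pfst (psnd z). pfst z \<le> k \<and> k \<in> set_decode (psnd (psnd z))"
  show "dec ?p" "dec ?q"
    by (intro dec_intros)+
  have "x \<in> (\<Union>i\<in>{i. ?q (prod_encode (n, i))}. cantor_basis i) \<longleftrightarrow> (\<exists>k\<ge>n. x k)" for n x
  proof
    assume "x \<in> (\<Union>i\<in>{i. ?q (prod_encode (n, i))}. cantor_basis i)"
    then show "\<exists>k\<ge>n. x k"
      by (auto simp: mem_cantor_basis)
  next
    assume "\<exists>k\<ge>n. x k"
    then obtain k where k: "k \<ge> n" "x k" by blast
    obtain a where "\<forall>j<Suc k. j \<in> set_decode a \<longleftrightarrow> x j"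
      using ex_code_less by blast
    with k show "x \<in> (\<Union>i\<in>{i. ?q (prod_encode (n, i))}. cantor_basis i)"
      by (intro UN_I[of "prod_encode (Suc k, a)"]) (auto simp: mem_cantor_basis intro!: exI[of _ k])
  qed
  then have diff: "x \<in> (\<Union>n. (\<Union>i\<in>{i. ?p (prod_encode (n, i))}. cantor_basis i) -
      (\<Union>i\<in>{i. ?q (prod_encode (n, i))}. cantor_basis i)) \<longleftrightarrow> (\<exists>n. \<forall>k\<ge>n. \<not> x k)" for x
    by simp
  have fin: "finite {k. x k} \<longleftrightarrow> (\<exists>n. \<forall>k\<ge>n. \<not> x k)" for x :: "nat \<Rightarrow> bool"
    unfolding finite_nat_set_iff_bounded by (metis mem_Collect_eq not_le)
  show "theta ` Pfin = (\<Union>n. (\<Union>i\<in>{i. ?p (prod_encode (n, i))}. cantor_basis i) -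
      (\<Union>i\<in>{i. ?q (prod_encode (n, i))}. cantor_basis i))"
    by (rule set_eqI, rule trans[OF _ diff[symmetric]]) (simp add: theta_Pfin fin)
qed

lemma mem_scott_basis: "X \<in> scott_basis i \<longleftrightarrow> set_decode i \<subseteq> X"
  by (simp add: scott_basis_def scott_base_def)

text \<open>As in the Cantor space; index 0 now codes the empty set, whose basic open family is
  everything.\<close>

lemma Pfin_eff_Sigma02: "Pfin \<in> eff_Sigma02 scott_basis"
proof (rule in_eff_Sigma02I)
  let ?p = "\<lambda>z. psnd z = 0"
  let ?q = "\<lambda>z. \<exists>k<psnd z. pfst z \<le> k \<and> k \<in> set_decode (psnd z)"
  show "dec ?p" "dec ?q"
    by (intro dec_intros)+
  have "X \<in> (\<Union>i\<in>{i. ?q (prod_encode (n, i))}. scott_basis i) \<longleftrightarrow> (\<exists>k\<ge>n. k \<in> X)" for n X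
  proof
    assume "X \<in> (\<Union>i\<in>{i. ?q (prod_encode (n, i))}. scott_basis i)"
    then show "\<exists>k\<ge>n. k \<in> X"
      by (auto simp: mem_scott_basis)
  next
    assume "\<exists>k\<ge>n. k \<in> X"
    then obtain k where k: "k \<ge> n" "k \<in> X" by blast
    have decode: "set_decode (set_encode {k}) = {k}"
      by (rule set_encode_inverse) simp
    then have "k < set_encode {k}"
      by (intro less_if_mem_set_decode) simp
    with k decode have "?q (prod_encode (n, set_encode {k}))" "X \<in> scott_basis (set_encode {k})"
      unfolding mem_scott_basis by auto
    then show "X \<in> (\<Union>i\<in>{i. ?q (prod_encode (n, i))}. scott_basis i)"
      by blast
  qed
  then have diff: "X \<in> (\<Union>n. (\<Union>i\<in>{i. ?p (prod_encode (n, i))}. scott_basis i) -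
      (\<Union>i\<in>{i. ?q (prod_encode (n, i))}. scott_basis i)) \<longleftrightarrow> (\<exists>n. \<forall>k\<ge>n. k \<notin> X)" for X
    by (simp add: mem_scott_basis)
  have fin: "finite X \<longleftrightarrow> (\<exists>n. \<forall>k\<ge>n. k \<notin> X)" for X :: "nat set"
    unfolding finite_nat_set_iff_bounded by (metis mem_Collect_eq not_le)
  show "Pfin = (\<Union>n. (\<Union>i\<in>{i. ?p (prod_encode (n, i))}. scott_basis i) -
      (\<Union>i\<in>{i. ?q (prod_encode (n, i))}. scott_basis i))"
    by (rule set_eqI, rule trans[OF _ diff[symmetric]]) (simp add: Pfin_def fin)
qed

section \<open>Hardness for the second level\<close>

lemma theta_apply: "theta X k \<longleftrightarrow> k \<in> X"
  by (simp add: theta_def)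

text \<open>The identity serves as a uniform modulus of continuity; this is what reduces inclusions
  between images and basic sets to finite checks.\<close>

definition causal :: "((nat \<Rightarrow> bool) \<Rightarrow> nat \<Rightarrow> bool) \<Rightarrow> bool" where
  "causal f \<longleftrightarrow> (\<forall>x y k. (\<forall>j<k. x j \<longleftrightarrow> y j) \<longrightarrow> f x k = f y k)"

lemma causalD:
  assumes "causal f" "\<And>j. j < n \<Longrightarrow> x j \<longleftrightarrow> y j" "k < n"
  shows "f x k = f y k"
proof -
  have "x j \<longleftrightarrow> y j" if "j < k" for j
    using that \<open>k < n\<close> by (intro assms(2)) (rule less_trans)
  with assms(1) show ?thesis
    unfolding causal_def by blast
qed

lemma continuous_map_causal:
  assumes "causal f"
  shows "continuous_map cantor cantor f"
  unfolding continuous_map_def openin_cantor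
proof (intro conjI allI impI ballI)
  fix U x assume U: "\<forall>x\<in>U. \<exists>i. x \<in> cantor_basis i \<and> cantor_basis i \<subseteq> U"
    and x: "x \<in> {x \<in> topspace cantor. f x \<in> U}"
  then obtain i where i: "f x \<in> cantor_basis i" "cantor_basis i \<subseteq> U" by auto
  obtain j where j: "x \<in> cantor_basis j" "\<And>y k. y \<in> cantor_basis j \<Longrightarrow> k < i \<Longrightarrow> y k = x k"
    using cantor_neighbourhood[of x i] by blast
  have "f y \<in> cantor_basis i" if "y \<in> cantor_basis j" for y
  proof -
    have "f y k = f x k" if "k < i" for k
      using assms j(2)[OF \<open>y \<in> cantor_basis j\<close>] that by (rule causalD)
    then have "f y \<in> cantor_basis i \<longleftrightarrow> f x \<in> cantor_basis i"
      by (rule cantor_basis_cong[OF _ order_refl])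
    with i(1) show ?thesis by simp
  qed
  with i(2) j(1) show "\<exists>i. x \<in> cantor_basis i \<and> cantor_basis i \<subseteq> {x \<in> topspace cantor. f x \<in> U}"
    by auto
qed simp

text \<open>Membership in the cylinder depends on at most \<open>i\<close> bits of the input, and
  membership of the image in \<open>T\<close> on at most \<open>j\<close> of them. Hence one finite
  set for each string of length \<open>i + j\<close> suffices as a test point.\<close>

lemma causal_image_subset_iff:
  assumes f: "causal f" and T: "\<And>y z. (\<And>k. k < j \<Longrightarrow> y k \<longleftrightarrow> z k) \<Longrightarrow> y \<in> T \<longleftrightarrow> z \<in> T"
  shows "f ` cantor_basis i \<subseteq> T \<longleftrightarrow> (\<forall>a<2 ^ (i + j).
    theta (set_decode a) \<in> cantor_basis i \<longrightarrow> f (theta (set_decode a)) \<in> T)"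
proof (intro iffI subsetI)
  fix y assume R: "\<forall>a<2 ^ (i + j).
    theta (set_decode a) \<in> cantor_basis i \<longrightarrow> f (theta (set_decode a)) \<in> T"
    and "y \<in> f ` cantor_basis i"
  then obtain x where x: "x \<in> cantor_basis i" "y = f x" by blast
  obtain a where a: "a < 2 ^ (i + j)" "\<forall>k<i + j. k \<in> set_decode a \<longleftrightarrow> x k"
    using ex_code_less by blast
  then have eq: "theta (set_decode a) k \<longleftrightarrow> x k" if "k < i + j" for k
    using that by (simp add: theta_def)
  have "theta (set_decode a) \<in> cantor_basis i"
    using x(1) cantor_basis_cong[OF eq, of i] by simp
  moreover have "f (theta (set_decode a)) k = f x k" if "k < j" for k
    using f eq by (rule causalD) (use that in auto)
  then have "f (theta (set_decode a)) \<in> T \<longleftrightarrow> f x \<in> T"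
    by (rule T)
  ultimately show "y \<in> T"
    using R a(1) x(2) by blast
qed blast

text \<open>In either target, membership in the basic set with index \<open>j\<close> depends on the
  first \<open>j\<close> bits only, so the inclusion relation is even decidable.\<close>

lemma eff_continuous_causal:
  assumes f: "causal f" and d: "dec (\<lambda>z. f (theta (set_decode (pfst z))) (psnd z))"
  shows "eff_continuous cantor cantor_basis cantor cantor_basis f"
    and "eff_continuous cantor cantor_basis scott scott_basis (\<lambda>x. Collect (f x))"
proof -
  have df: "dec (\<lambda>z. f (theta (set_decode (a z))) (b z))" if "computable a" "computable b" for a b
    using dec_comp[OF d computable_prod_encode[OF that]] by simp
  have "f ` cantor_basis i \<subseteq> cantor_basis j \<longleftrightarrow> (\<forall>a<2 ^ (i + j).
      theta (set_decode a) \<in> cantor_basis i \<longrightarrow> f (theta (set_decode a)) \<in> cantor_basis j)" for i j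
    using f cantor_basis_cong[OF _ order_refl] by (rule causal_image_subset_iff)
  moreover have "dec (\<lambda>z. \<forall>a<2 ^ (pfst z + psnd z). theta (set_decode a) \<in> cantor_basis (pfst z) \<longrightarrow>
      f (theta (set_decode a)) \<in> cantor_basis (psnd z))"
    unfolding mem_cantor_basis by (simp only: theta_apply) (intro dec_intros df)
  ultimately have "ce_rel {(i, j). f ` cantor_basis i \<subseteq> cantor_basis j}"
    by (intro ce_rel_dec) (simp only:)
  with continuous_map_causal[OF f]
  show "eff_continuous cantor cantor_basis cantor cantor_basis f"
    unfolding eff_continuous_def by blast
  have "(\<lambda>x. Collect (f x)) ` cantor_basis i \<subseteq> scott_basis j \<longleftrightarrow>
      f ` cantor_basis i \<subseteq> {y. \<forall>k<j. k \<in> set_decode j \<longrightarrow> y k}" for i j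
    by (simp add: image_subset_iff mem_scott_basis set_decode_subset_iff)
  moreover have "f ` cantor_basis i \<subseteq> {y. \<forall>k<j. k \<in> set_decode j \<longrightarrow> y k} \<longleftrightarrow> (\<forall>a<2 ^ (i + j).
      theta (set_decode a) \<in> cantor_basis i \<longrightarrow>
      f (theta (set_decode a)) \<in> {y. \<forall>k<j. k \<in> set_decode j \<longrightarrow> y k})" for i j
    by (rule causal_image_subset_iff[OF f]) simp
  moreover have "dec (\<lambda>z. \<forall>a<2 ^ (pfst z + psnd z). theta (set_decode a) \<in> cantor_basis (pfst z) \<longrightarrow>
      f (theta (set_decode a)) \<in> {y. \<forall>k<psnd z. k \<in> set_decode (psnd z) \<longrightarrow> y k})"
    unfolding mem_cantor_basis mem_Collect_eq
    by (simp only: theta_apply) (intro dec_intros df)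
  ultimately have "ce_rel {(i, j). (\<lambda>x. Collect (f x)) ` cantor_basis i \<subseteq> scott_basis j}"
    by (intro ce_rel_dec) (simp only:)
  with continuous_map_compose[OF continuous_map_causal[OF f] continuous_map_Collect]
  show "eff_continuous cantor cantor_basis scott scott_basis (\<lambda>x. Collect (f x))"
    unfolding eff_continuous_def o_def by blast
qed

section \<open>Normal form for second-level sets and the set of refutation times\<close>

definition diff_union :: "(nat \<Rightarrow> bool) \<Rightarrow> (nat \<Rightarrow> bool) \<Rightarrow> (nat \<Rightarrow> bool) set" where
  "diff_union p q = (\<Union>n. (\<Union>i\<in>{i. \<exists>t. p (prod_encode (n, prod_encode (i, t)))}. cantor_basis i) -
     (\<Union>i\<in>{i. \<exists>t. q (prod_encode (n, prod_encode (i, t)))}. cantor_basis i))"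

text \<open>Keeping the stage \<open>t\<close> of each enumeration inside the code leaves only
  decidable predicates. Boldface sets get the same shape with arbitrary predicates, so one
  construction serves both.\<close>

lemma eff_Sigma02_diff_union:
  assumes "S \<in> eff_Sigma02 cantor_basis"
  obtains p q where "dec p" "dec q" "S = diff_union p q"
proof -
  from assms obtain P Q where PQ: "ce_rel P" "ce_rel Q"
    and S: "S = (\<Union>n. (\<Union>i\<in>{i. (n, i) \<in> P}. cantor_basis i) - (\<Union>i\<in>{i. (n, i) \<in> Q}. cantor_basis i))"
    unfolding eff_Sigma02_def by blast
  from PQ obtain p q where "dec p" "P = {(n, i). \<exists>t. p (prod_encode (n, prod_encode (i, t)))}"
    "dec q" "Q = {(n, i). \<exists>t. q (prod_encode (n, prod_encode (i, t)))}"
    unfolding ce_rel_iff_dec by blast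
  with S that show thesis
    by (simp add: diff_union_def)
qed

lemma Sigma02_diff_union:
  assumes "S \<in> Sigma02 cantor"
  obtains p q where "S = diff_union p q"
proof -
  obtain U V :: "nat \<Rightarrow> _" where UV: "\<forall>n. openin cantor (U n)" "\<forall>n. openin cantor (V n)"
    and S: "S = (\<Union>n. U n - V n)"
    using assms by (rule Sigma02E)
  have "W = (\<Union>i\<in>{i. cantor_basis i \<subseteq> W}. cantor_basis i)" if "openin cantor W" for W
    using that unfolding openin_cantor by blast
  with UV have "U n = (\<Union>i\<in>{i. cantor_basis i \<subseteq> U n}. cantor_basis i)"
    "V n = (\<Union>i\<in>{i. cantor_basis i \<subseteq> V n}. cantor_basis i)" for n
    by blast+
  \<comment> \<open>All cylinders contained in the given open sets are listed; the stage component
    is ignored.\<close>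
  then have "S = diff_union (\<lambda>z. cantor_basis (pfst (psnd z)) \<subseteq> U (pfst z))
      (\<lambda>z. cantor_basis (pfst (psnd z)) \<subseteq> V (pfst z))"
    unfolding S diff_union_def by simp
  then show thesis
    by (rule that)
qed

text \<open>Here \<open>m\<close> codes \<open>(n, (i, t))\<close> and names cylinder
  \<open>i\<close> minus the \<open>n\<close>-th removed open set, provided \<open>p m\<close>
  holds. Leaving the cylinder is noticed at once; entering the removed set is noticed through some
  \<open>v\<close> coding an index and a stage.\<close>

definition refuted :: "(nat \<Rightarrow> bool) \<Rightarrow> (nat \<Rightarrow> bool) \<Rightarrow> (nat \<Rightarrow> bool) \<Rightarrow> nat \<Rightarrow> nat \<Rightarrow> bool" where
  "refuted p q x m s \<longleftrightarrow> (p m \<longrightarrow> x \<in> cantor_basis (pfst (psnd m)) \<longrightarrow>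
     (\<exists>v\<le>s. q (prod_encode (pfst m, v)) \<and> x \<in> cantor_basis (pfst v)))"

text \<open>Keeping \<open>j\<close> in the code \<open>(j, s)\<close> makes the set infinite even
  when the first stages \<open>s\<close> stay bounded.\<close>

definition refutation_times :: "(nat \<Rightarrow> bool) \<Rightarrow> (nat \<Rightarrow> bool) \<Rightarrow> (nat \<Rightarrow> bool) \<Rightarrow> nat \<Rightarrow> bool" where
  "refutation_times p q x z \<longleftrightarrow> (\<forall>m\<le>pfst z. refuted p q x m (psnd z)) \<and>
     (\<forall>s<psnd z. \<not> (\<forall>m\<le>pfst z. refuted p q x m s))"

lemma refuted_mono: "refuted p q x m s \<Longrightarrow> s \<le> t \<Longrightarrow> refuted p q x m t"
  unfolding refuted_def by (meson order_trans)

lemma mem_diff_union_iff: "x \<in> diff_union p q \<longleftrightarrow> (\<exists>m. \<forall>s. \<not> refuted p q x m s)"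
proof
  assume "x \<in> diff_union p q"
  then obtain n i t where "p (prod_encode (n, prod_encode (i, t)))" "x \<in> cantor_basis i"
    and "\<And>k u. q (prod_encode (n, prod_encode (k, u))) \<Longrightarrow> x \<notin> cantor_basis k"
    unfolding diff_union_def by blast
  then have "\<not> refuted p q x (prod_encode (n, prod_encode (i, t))) s" for s
    unfolding refuted_def by (metis pfst_encode prod_encode_pfst_psnd psnd_encode)
  then show "\<exists>m. \<forall>s. \<not> refuted p q x m s"
    by blast
next
  assume "\<exists>m. \<forall>s. \<not> refuted p q x m s"
  then obtain m where m: "\<And>s. \<not> refuted p q x m s" by blast
  have "p (prod_encode (pfst m, prod_encode (pfst (psnd m), psnd (psnd m))))"
    "x \<in> cantor_basis (pfst (psnd m))"
    using m unfolding refuted_def by auto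
  moreover have "x \<notin> cantor_basis k" if "q (prod_encode (pfst m, prod_encode (k, u)))" for k u
    using m[of "prod_encode (k, u)"] that unfolding refuted_def by force
  ultimately show "x \<in> diff_union p q"
    unfolding diff_union_def by blast
qed

lemma finite_refutation_times: "finite {z. refutation_times p q x z} \<longleftrightarrow> x \<in> diff_union p q"
proof
  assume "x \<in> diff_union p q"
  then obtain m where m: "\<And>s. \<not> refuted p q x m s"
    unfolding mem_diff_union_iff by blast
  \<comment> \<open>A piece \<open>m\<close> that is never refuted blocks every
    \<open>j \<ge> m\<close>.\<close>
  have "pfst ` {z. refutation_times p q x z} \<subseteq> {..<m}"
  proof clarify
    fix z assume "refutation_times p q x z"
    with m show "pfst z < m"
      unfolding refutation_times_def by (meson not_le)
  qed
  then have "finite (pfst ` {z. refutation_times p q x z})"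
    by (rule finite_subset) simp
  \<comment> \<open>Minimality of the stage leaves at most one code for each
    \<open>j\<close>.\<close>
  moreover have "inj_on pfst {z. refutation_times p q x z}"
  proof (rule inj_onI)
    have le: "psnd w \<le> psnd z"
      if "refutation_times p q x z" "refutation_times p q x w" "pfst z = pfst w" for z w
      using that unfolding refutation_times_def not_less[symmetric] by auto
    fix z w assume "z \<in> {z. refutation_times p q x z}" "w \<in> {z. refutation_times p q x z}"
      and eq: "pfst z = pfst w"
    with le[of z w] le[of w z] have "prod_encode (pfst z, psnd z) = prod_encode (pfst w, psnd w)"
      by simp
    then show "z = w"
      by (simp only: prod_encode_pfst_psnd)
  qed
  ultimately show "finite {z. refutation_times p q x z}"
    by (rule finite_imageD)
next
  assume fin: "finite {z. refutation_times p q x z}"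
  show "x \<in> diff_union p q"
  proof (rule ccontr)
    assume "x \<notin> diff_union p q"
    then have "\<forall>m. \<exists>s. refuted p q x m s"
      unfolding mem_diff_union_iff by blast
    from choice[OF this] obtain T where T: "\<forall>m. refuted p q x m (T m)"
      by blast
    have "j \<in> pfst ` {z. refutation_times p q x z}" for j
    proof -
      let ?R = "\<lambda>s. \<forall>m\<le>j. refuted p q x m s"
      \<comment> \<open>Refutation is monotone in the stage, so the maximum of the individual stages
        refutes all pieces up to \<open>j\<close>.\<close>
      have "?R (Max (T ` {..j}))"
        by (intro allI impI refuted_mono[OF T[rule_format]] Max_ge) auto
      then have "?R (Least ?R)"
        by (rule LeastI)
      moreover have "\<not> ?R s" if "s < Least ?R" for s
        using that by (rule not_less_Least)
      ultimately have "refutation_times p q x (prod_encode (j, Least ?R))"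
        unfolding refutation_times_def pfst_encode psnd_encode by blast
      then show ?thesis
        by (intro image_eqI[of _ _ "prod_encode (j, Least ?R)"]) simp_all
    qed
    then have "pfst ` {z. refutation_times p q x z} = UNIV"
      by blast
    with fin show False
      by (metis finite_imageI infinite_UNIV_nat)
  qed
qed

text \<open>Components of a pair are at most its code, so bit \<open>z\<close> consults only
  cylinders with index at most \<open>z\<close>, and these are determined by the bits below
  \<open>z\<close>.\<close>

lemma causal_refutation_times: "causal (refutation_times p q)"
  unfolding causal_def
proof (intro allI impI)
  fix x y :: "nat \<Rightarrow> bool" and z assume eq: "\<forall>j<z. x j \<longleftrightarrow> y j"
  have cong: "x \<in> cantor_basis i \<longleftrightarrow> y \<in> cantor_basis i" if "i \<le> z" for i
    using eq that by (intro cantor_basis_cong[of z]) auto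
  have "refuted p q x m s \<longleftrightarrow> refuted p q y m s" if "m \<le> z" "s \<le> z" for m s
  proof -
    have "pfst (psnd m) \<le> z" "pfst v \<le> z" if "v \<le> s" for v
      using \<open>m \<le> z\<close> \<open>s \<le> z\<close> that pfst_le[of "psnd m"] psnd_le[of m] pfst_le[of v] by linarith+
    with cong show ?thesis
      unfolding refuted_def by (metis le0)
  qed
  then show "refutation_times p q x z = refutation_times p q y z"
    unfolding refutation_times_def using pfst_le[of z] psnd_le[of z]
    by (meson order_trans less_imp_le)
qed

text \<open>All quantifiers are bounded once the point is given by the code of a finite set.\<close>

lemma dec_refutation_times:
  assumes "dec p" "dec q"
  shows "dec (\<lambda>z. refutation_times p q (theta (set_decode (pfst z))) (psnd z))"
  unfolding refutation_times_def refuted_def mem_cantor_basis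
  by (simp only: theta_apply)
    (intro dec_intros dec_comp[OF assms(1)] dec_comp[OF assms(2)])

section \<open>Boldface and effective hardness for the second level of the Cantor space\<close>

lemma theta_Pfin_hard:
  "wadge_hard cantor (theta ` Pfin) cantor (Sigma02 cantor)"
  "wadge_hard scott Pfin cantor (Sigma02 cantor)"
proof -
  have "\<exists>f. continuous_map cantor cantor f \<and> S = {x. finite {k. f x k}}" if S: "S \<in> Sigma02 cantor" for S
  proof -
    obtain p q where "S = diff_union p q"
      using S by (rule Sigma02_diff_union)
    then show ?thesis
      using continuous_map_causal[OF causal_refutation_times] finite_refutation_times[of p q]
      by (intro exI[of _ "refutation_times p q"]) simp
  qed
  note reduction = this
  show "wadge_hard cantor (theta ` Pfin) cantor (Sigma02 cantor)"
    using reduction by (simp add: wadge_hard_def wadge_reducible_def theta_Pfin)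
  have "\<exists>f. continuous_map cantor scott f \<and> S = {x. finite (f x)}" if "S \<in> Sigma02 cantor" for S
  proof -
    obtain f where "continuous_map cantor cantor f" "S = {x. finite {k. f x k}}"
      using reduction[OF \<open>S \<in> Sigma02 cantor\<close>] by blast
    then show ?thesis
      using continuous_map_compose[OF _ continuous_map_Collect]
      by (intro exI[of _ "Collect \<circ> f"]) simp
  qed
  then show "wadge_hard scott Pfin cantor (Sigma02 cantor)"
    by (simp add: wadge_hard_def wadge_reducible_def Pfin_def)
qed

lemma theta_Pfin_eff_hard:
  "eff_wadge_hard cantor cantor_basis (theta ` Pfin) cantor cantor_basis (eff_Sigma02 cantor_basis)"
  "eff_wadge_hard scott scott_basis Pfin cantor cantor_basis (eff_Sigma02 cantor_basis)"
proof -
  have "\<exists>f. eff_continuous cantor cantor_basis cantor cantor_basis f \<and>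
      eff_continuous cantor cantor_basis scott scott_basis (\<lambda>x. Collect (f x)) \<and>
      S = {x. finite {k. f x k}}" if S: "S \<in> eff_Sigma02 cantor_basis" for S
  proof -
    obtain p q where "dec p" "dec q" "S = diff_union p q"
      using S by (rule eff_Sigma02_diff_union)
    then show ?thesis
      using eff_continuous_causal[OF causal_refutation_times dec_refutation_times]
        finite_refutation_times[of p q]
      by (intro exI[of _ "refutation_times p q"]) simp
  qed
  note reduction = this
  show "eff_wadge_hard cantor cantor_basis (theta ` Pfin) cantor cantor_basis (eff_Sigma02 cantor_basis)"
    unfolding eff_wadge_hard_def eff_wadge_reducible_def theta_Pfin topspace_cantor
    using reduction by simp blast
  have "\<exists>f. eff_continuous cantor cantor_basis scott scott_basis f \<and> S = {x. finite (f x)}"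
    if "S \<in> eff_Sigma02 cantor_basis" for S
    using reduction[OF that] by blast
  then show "eff_wadge_hard scott scott_basis Pfin cantor cantor_basis (eff_Sigma02 cantor_basis)"
    by (simp add: eff_wadge_hard_def eff_wadge_reducible_def Pfin_def)
qed

section \<open>Hardness and non-hardness for the Scott topology\<close>

definition witnesses :: "(nat \<Rightarrow> bool) \<Rightarrow> nat set \<Rightarrow> nat set" where
  "witnesses d X = {k. \<exists>v\<le>k. d v \<and> set_decode (pfst v) \<subseteq> X}"

text \<open>Once some \<open>v\<close> certifies that \<open>X\<close> lies in the open family,
  every \<open>k \<ge> v\<close> is a member; without a certificate the set is empty.\<close>

lemma finite_witnesses_iff:
  "finite (witnesses d X) \<longleftrightarrow> X \<notin> (\<Union>i\<in>{i. \<exists>t. d (prod_encode (i, t))}. scott_basis i)"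
proof
  assume "X \<notin> (\<Union>i\<in>{i. \<exists>t. d (prod_encode (i, t))}. scott_basis i)"
  then have "\<not> set_decode (pfst v) \<subseteq> X" if "d v" for v
    using that by (metis (mono_tags, lifting) UN_I mem_Collect_eq mem_scott_basis prod_encode_pfst_psnd)
  then have "witnesses d X = {}"
    unfolding witnesses_def by blast
  then show "finite (witnesses d X)"
    by simp
next
  assume fin: "finite (witnesses d X)"
  show "X \<notin> (\<Union>i\<in>{i. \<exists>t. d (prod_encode (i, t))}. scott_basis i)"
  proof
    assume "X \<in> (\<Union>i\<in>{i. \<exists>t. d (prod_encode (i, t))}. scott_basis i)"
    then obtain i t where "d (prod_encode (i, t))" "set_decode i \<subseteq> X"
      by (auto simp: mem_scott_basis)
    then have "{prod_encode (i, t)..} \<subseteq> witnesses d X"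
      unfolding witnesses_def by (auto intro!: exI[of _ "prod_encode (i, t)"])
    with fin show False
      using infinite_Ici finite_subset by blast
  qed
qed

lemma continuous_map_witnesses: "continuous_map scott scott (witnesses d)"
proof (rule continuous_map_scottI)
  fix k
  have "{X \<in> topspace scott. k \<in> witnesses d X} = (\<Union>v\<in>{v. v \<le> k \<and> d v}. scott_basis (pfst v))"
    by (auto simp: witnesses_def mem_scott_basis)
  then show "openin scott {X \<in> topspace scott. k \<in> witnesses d X}"
    using openin_scott_basis by auto
qed

text \<open>By monotonicity the inclusion need only be tested at \<open>set_decode i\<close>, the
  least element of \<open>scott_basis i\<close>. That test is a bounded check.\<close>

lemma eff_continuous_witnesses:
  assumes "dec d"
  shows "eff_continuous scott scott_basis scott scott_basis (witnesses d)"
proof -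
  have "witnesses d ` scott_basis i \<subseteq> scott_basis j \<longleftrightarrow> (\<forall>k<j. k \<in> set_decode j \<longrightarrow>
      (\<exists>v\<le>k. d v \<and> (\<forall>l<pfst v. l \<in> set_decode (pfst v) \<longrightarrow> l \<in> set_decode i)))" for i j
  proof -
    have "witnesses d ` scott_basis i \<subseteq> scott_basis j \<longleftrightarrow> set_decode j \<subseteq> witnesses d (set_decode i)"
    proof
      assume "witnesses d ` scott_basis i \<subseteq> scott_basis j"
      moreover have "set_decode i \<in> scott_basis i"
        by (simp add: mem_scott_basis)
      ultimately have "witnesses d (set_decode i) \<in> scott_basis j"
        by blast
      then show "set_decode j \<subseteq> witnesses d (set_decode i)"
        by (simp add: mem_scott_basis)
    next
      assume sub: "set_decode j \<subseteq> witnesses d (set_decode i)"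
      show "witnesses d ` scott_basis i \<subseteq> scott_basis j"
      proof (rule image_subsetI)
        fix X assume "X \<in> scott_basis i"
        then have "set_decode i \<subseteq> X"
          by (simp only: mem_scott_basis)
        with continuous_map_witnesses have "witnesses d (set_decode i) \<subseteq> witnesses d X"
          by (rule continuous_map_scott_mono)
        with sub show "witnesses d X \<in> scott_basis j"
          unfolding mem_scott_basis by (rule order_trans)
      qed
    qed
    then show ?thesis
      unfolding set_decode_subset_iff[of j] witnesses_def mem_Collect_eq set_decode_subset_iff[of "pfst _"] .
  qed
  moreover have "dec (\<lambda>z. \<forall>k<psnd z. k \<in> set_decode (psnd z) \<longrightarrow>
      (\<exists>v\<le>k. d v \<and> (\<forall>l<pfst v. l \<in> set_decode (pfst v) \<longrightarrow> l \<in> set_decode (pfst z))))"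
    by (intro dec_intros dec_comp[OF assms])
  ultimately have "ce_rel {(i, j). witnesses d ` scott_basis i \<subseteq> scott_basis j}"
    by (intro ce_rel_dec) (simp only:)
  then show ?thesis
    unfolding eff_continuous_def using continuous_map_witnesses by blast
qed

lemma Pfin_hard_Pi01: "wadge_hard scott Pfin scott (Pi01 scott)"
  unfolding wadge_hard_def wadge_reducible_def
proof
  fix S assume "S \<in> Pi01 scott"
  then have op: "openin scott (- S)"
    by (simp add: Pi01_def closedin_def Compl_eq_Diff_UNIV)
  \<comment> \<open>Lists every basic open family inside the complement; the stage component is
    ignored.\<close>
  let ?d = "\<lambda>v. scott_basis (pfst v) \<subseteq> - S"
  have "X \<in> - S \<longleftrightarrow> (\<exists>i. X \<in> scott_basis i \<and> scott_basis i \<subseteq> - S)" for X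
  proof
    assume "X \<in> - S"
    with op obtain A where "finite A" "A \<subseteq> X" "scott_base A \<subseteq> - S"
      unfolding openin_scott by blast
    then show "\<exists>i. X \<in> scott_basis i \<and> scott_basis i \<subseteq> - S"
      by (intro exI[of _ "set_encode A"]) (simp add: scott_basis_def scott_base_def)
  qed blast
  then have "X \<in> S \<longleftrightarrow> finite (witnesses ?d X)" for X
    unfolding finite_witnesses_iff by auto
  then show "\<exists>f. continuous_map scott scott f \<and> S = {x \<in> topspace scott. f x \<in> Pfin}"
    using continuous_map_witnesses[of ?d] by (intro exI[of _ "witnesses ?d"]) (auto simp: Pfin_def)
qed

lemma Pfin_eff_hard_Pi01: "eff_wadge_hard scott scott_basis Pfin scott scott_basis (eff_Pi01 scott_basis)"
  unfolding eff_wadge_hard_def eff_wadge_reducible_def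
proof
  fix S assume "S \<in> eff_Pi01 scott_basis"
  then obtain W where W: "ce W" and S: "S = - (\<Union>i\<in>W. scott_basis i)"
    unfolding eff_Pi01_def eff_Sigma01_def by blast
  from W obtain d where d: "dec d" "W = {i. \<exists>t. d (prod_encode (i, t))}"
    unfolding ce_iff_dec by blast
  then have "S = {x \<in> topspace scott. witnesses d x \<in> Pfin}"
    unfolding S by (auto simp: Pfin_def finite_witnesses_iff)
  with eff_continuous_witnesses[OF d(1)]
  show "\<exists>f. eff_continuous scott scott_basis scott scott_basis f \<and> S = {x \<in> topspace scott. f x \<in> Pfin}"
    by blast
qed

section \<open>Obstructions from monotonicity\<close>

lemma open_not_reducible_Pfin:
  assumes U: "openin scott U" "U \<noteq> {}" "U \<noteq> UNIV"
  shows "\<not> wadge_reducible scott U scott Pfin"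
proof
  assume "wadge_reducible scott U scott Pfin"
  then obtain f where f: "continuous_map scott scott f" and eq: "U = {X. f X \<in> Pfin}"
    unfolding wadge_reducible_def by auto
  from U obtain X Y where XY: "X \<in> U" "Y \<notin> U" by blast
  \<comment> \<open>An open family containing the empty set contains every set.\<close>
  then have "{} \<notin> U"
    using openin_scott_upward[OF U(1), of "{}" Y] by blast
  with eq XY(1) have "infinite (f {})" "finite (f X)"
    by (auto simp: Pfin_def)
  moreover have "f {} \<subseteq> f X"
    using f by (rule continuous_map_scott_mono) simp
  ultimately show False
    using finite_subset by blast
qed

text \<open>
  Membership in the family below alternates along the chain of the sets \<open>{1..n}\<close>, while the upper
  bound \<open>UNIV\<close> of that chain is a member. A reduction to a family of finite sets would map
  the chain to an infinite strictly increasing chain of subsets of the finite image of \<open>UNIV\<close>.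
\<close>

definition alternating :: "nat set set" where
  "alternating = {X. 0 \<in> X} \<union> (\<Union>n. scott_base {1..2 * n} - scott_base {1..2 * n + 1})"

lemma alternating_eff_Sigma02: "alternating \<in> eff_Sigma02 scott_basis"
proof (rule in_eff_Sigma02I)
  \<comment> \<open>Piece 0 is the family of sets containing 0, with nothing removed, and piece
    \<open>Suc n\<close> is the \<open>n\<close>-th difference; hence the shift
    \<open>pfst z - 1\<close>. \<open>Suc k\<close> appears because the intervals start at
    1.\<close>
  let ?p = "\<lambda>z. (pfst z = 0 \<and> 0 \<in> set_decode (psnd z)) \<or>
    (0 < pfst z \<and> (\<forall>k<2 * (pfst z - 1). Suc k \<in> set_decode (psnd z)))"
  let ?q = "\<lambda>z. 0 < pfst z \<and> (\<forall>k<2 * (pfst z - 1) + 1. Suc k \<in> set_decode (psnd z))"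
  show "dec ?p" "dec ?q"
    by (intro dec_intros)+
  \<comment> \<open>Admitting all indices whose finite set includes \<open>A\<close> yields the same
    union as the index of \<open>A\<close> alone and avoids computing the code of an
    interval.\<close>
  have base: "(\<Union>i\<in>{i. A \<subseteq> set_decode i}. scott_basis i) = scott_base A" if "finite A" for A
  proof
    show "scott_base A \<subseteq> (\<Union>i\<in>{i. A \<subseteq> set_decode i}. scott_basis i)"
      using that by (intro subsetI UN_I[of "set_encode A"]) (auto simp: scott_basis_def)
  qed (auto simp: scott_basis_def scott_base_def)
  have interval: "(\<forall>k<n. Suc k \<in> A) \<longleftrightarrow> {1..n} \<subseteq> A" for n A
  proof
    assume all: "\<forall>k<n. Suc k \<in> A"
    show "{1..n} \<subseteq> A"
    proof
      fix k assume "k \<in> {1..n}"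
      then obtain j where "k = Suc j" "j < n"
        by (cases k) auto
      with all show "k \<in> A" by simp
    qed
  qed auto
  let ?D = "\<lambda>n. (\<Union>i\<in>{i. ?p (prod_encode (n, i))}. scott_basis i) -
      (\<Union>i\<in>{i. ?q (prod_encode (n, i))}. scott_basis i)"
  have "?D 0 = {X. 0 \<in> X}"
    using base[of "{0}"] by (simp add: scott_base_def)
  moreover have "?D (Suc n) = scott_base {1..2 * n} - scott_base {1..2 * n + 1}" for n
    using base[of "{1..2 * n}"] base[of "{1..2 * n + 1}"]
    unfolding pfst_encode psnd_encode interval by simp
  ultimately have "alternating = ?D 0 \<union> (\<Union>n. ?D (Suc n))"
    unfolding alternating_def by (simp only:)
  also have "\<dots> = (\<Union>n. ?D n)"
  proof -
    have "E 0 \<union> (\<Union>n. E (Suc n)) = (\<Union>n. E n)" for E :: "nat \<Rightarrow> nat set set"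
    proof
      show "(\<Union>n. E n) \<subseteq> E 0 \<union> (\<Union>n. E (Suc n))"
      proof (rule UN_least)
        fix n show "E n \<subseteq> E 0 \<union> (\<Union>n. E (Suc n))"
          by (cases n) auto
      qed
    qed blast
    then show ?thesis .
  qed
  finally show "alternating = (\<Union>n. ?D n)" .
qed

text \<open>The interval omits 0, and it lies in the \<open>m\<close>-th difference iff
  \<open>2 * m \<le> n < 2 * m + 1\<close>, that is, iff \<open>n = 2 * m\<close>.\<close>

lemma interval_mem_alternating: "{1..n} \<in> alternating \<longleftrightarrow> even n"
proof -
  have subset: "{1..a} \<subseteq> {1..n} \<longleftrightarrow> a \<le> n" for a
    by auto
  have "{1..n} \<in> alternating \<longleftrightarrow> (\<exists>m. 2 * m \<le> n \<and> \<not> 2 * m + 1 \<le> n)"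
    unfolding alternating_def scott_base_def by (simp add: subset[unfolded One_nat_def] del: atLeastatMost_subset_iff)
  also have "\<dots> \<longleftrightarrow> even n"
    by presburger
  finally show ?thesis .
qed

lemma alternating_not_reducible:
  assumes "F \<subseteq> Pfin"
  shows "\<not> wadge_reducible scott alternating scott F"
proof
  assume "wadge_reducible scott alternating scott F"
  then obtain f where f: "continuous_map scott scott f" and eq: "alternating = {X. f X \<in> F}"
    unfolding wadge_reducible_def by auto
  let ?g = "\<lambda>n :: nat. f {1..n}"
  have "?g n \<subset> ?g (Suc n)" for n
  proof
    show "?g n \<subseteq> ?g (Suc n)"
      using f by (rule continuous_map_scott_mono) auto
    \<comment> \<open>Exactly one of two consecutive intervals is in the family, so exactly one of
      their images is in \<open>F\<close>.\<close>
    show "?g n \<noteq> ?g (Suc n)"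
      using interval_mem_alternating[of n] interval_mem_alternating[of "Suc n"] unfolding eq
      by auto
  qed
  then have "inj ?g"
    by (intro strict_mono_imp_inj_on strict_monoI_Suc)
  moreover have "range ?g \<subseteq> Pow (f UNIV)"
    using continuous_map_scott_mono[OF f, of _ UNIV] by auto
  moreover have "UNIV \<in> alternating"
    by (simp add: alternating_def)
  with eq assms have "finite (f UNIV)"
    by (auto simp: Pfin_def)
  ultimately show False
    by (meson finite_Pow_iff finite_subset range_inj_infinite)
qed

section \<open>Remaining class memberships and the combined statement\<close>

lemma theta_Pfin_Sigma02: "theta ` Pfin \<in> Sigma02 cantor"
  using theta_Pfin_eff_Sigma02 eff_Sigma02_subset[of cantor cantor_basis] openin_cantor_basis by blast

lemma Pfin_notin_Pi02: "Pfin \<notin> Pi02 scott"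
proof
  assume "Pfin \<in> Pi02 scott"
  from Pi02_preimage[OF continuous_map_Collect this] show False
    using theta_Pfin_notin_Pi02 by (simp add: theta_image)
qed

theorem theorem5p10:
  shows
    "(wadge_complete cantor (theta ` Pfin) (Sigma02 cantor) \<and>
      eff_wadge_complete cantor cantor_basis (theta ` Pfin) (eff_Sigma02 cantor_basis) \<and>
      theta ` Pfin \<in> eff_Sigma02 cantor_basis - Pi02 cantor) \<and>
     (Pfin \<in> eff_Sigma02 scott_basis - Pi02 scott) \<and>
     (wadge_hard scott Pfin cantor (Sigma02 cantor) \<and>
      wadge_hard scott Pfin scott (Pi01 scott) \<and>
      eff_wadge_hard scott scott_basis Pfin cantor cantor_basis (eff_Sigma02 cantor_basis) \<and>
      eff_wadge_hard scott scott_basis Pfin scott scott_basis (eff_Pi01 scott_basis)) \<and>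
     ((\<forall>U \<in> Sigma01 scott. U \<noteq> {} \<and> U \<noteq> UNIV \<longrightarrow> \<not> wadge_reducible scott U scott Pfin) \<and>
      (\<forall>U \<in> eff_Sigma01 scott_basis. U \<noteq> {} \<and> U \<noteq> UNIV \<longrightarrow>
         \<not> eff_wadge_reducible scott scott_basis U scott scott_basis Pfin)) \<and>
     ((\<forall>F. F \<subseteq> Pfin \<longrightarrow> \<not> wadge_hard scott F scott (Sigma02 scott)) \<and>
      (\<forall>F. F \<subseteq> Pfin \<longrightarrow>
         \<not> eff_wadge_hard scott scott_basis F scott scott_basis (eff_Sigma02 scott_basis)))"
proof (intro conjI)
  show "wadge_complete cantor (theta ` Pfin) (Sigma02 cantor)"
    unfolding wadge_complete_def using theta_Pfin_Sigma02 theta_Pfin_hard(1) by blast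
  show "eff_wadge_complete cantor cantor_basis (theta ` Pfin) (eff_Sigma02 cantor_basis)"
    unfolding eff_wadge_complete_def using theta_Pfin_eff_Sigma02 theta_Pfin_eff_hard(1) by blast
  show "theta ` Pfin \<in> eff_Sigma02 cantor_basis - Pi02 cantor"
    using theta_Pfin_eff_Sigma02 theta_Pfin_notin_Pi02 by blast
  show "Pfin \<in> eff_Sigma02 scott_basis - Pi02 scott"
    using Pfin_eff_Sigma02 Pfin_notin_Pi02 by blast
  show "\<forall>U \<in> Sigma01 scott. U \<noteq> {} \<and> U \<noteq> UNIV \<longrightarrow> \<not> wadge_reducible scott U scott Pfin"
    using open_not_reducible_Pfin by (auto simp: Sigma01_def)
  \<comment> \<open>Effective classes and effective reductions are instances of the boldface ones,
    so the boldface negative result carries over.\<close>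
  then show "\<forall>U \<in> eff_Sigma01 scott_basis. U \<noteq> {} \<and> U \<noteq> UNIV \<longrightarrow>
      \<not> eff_wadge_reducible scott scott_basis U scott scott_basis Pfin"
    using eff_Sigma01_subset[of scott scott_basis, OF openin_scott_basis]
    by (meson eff_wadge_reducible_imp subsetD)
  \<comment> \<open>The counterexample \<open>alternating\<close> is lightface yet not even
    continuously reducible to \<open>F\<close>, so it refutes both the boldface and the effective
    hardness.\<close>
  show "\<forall>F. F \<subseteq> Pfin \<longrightarrow> \<not> wadge_hard scott F scott (Sigma02 scott)"
    using eff_Sigma02_subset[of scott scott_basis, OF openin_scott_basis]
    unfolding wadge_hard_def by (meson alternating_eff_Sigma02 alternating_not_reducible subsetD)
  show "\<forall>F. F \<subseteq> Pfin \<longrightarrow>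
      \<not> eff_wadge_hard scott scott_basis F scott scott_basis (eff_Sigma02 scott_basis)"
    unfolding eff_wadge_hard_def
    by (meson alternating_eff_Sigma02 alternating_not_reducible eff_wadge_reducible_imp)
qed (rule theta_Pfin_hard theta_Pfin_eff_hard Pfin_hard_Pi01 Pfin_eff_hard_Pi01)+

end
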